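(* Let $\nu>0$ and let $K$ satisfy $0<K<\frac{\nu^2}{2}$. Assume the potentials $(\Phi_m)_{m\in\mathbb{N}}$ satisfy the standing assumptions listed in the context. Then there exist $W_K\in \mathsf{L}^2(\mathbb{R})$ with $\|W_K\|_2^2=2K$, a wave speed $c_K>0$ and a constant $\eta\in\mathbb{R}$ such that $$c_K^2\,W_K(x)=\sum_{m=1}^\infty A_m\big(-\Phi_m'(\nu m-A_mW_K)\big)(x)+\eta \quad\text{for (almost) all } x\in\mathbb{R}.$$ In particular this yields a one-parameter family $(W_K,c_K)$, $0<K<\nu^2/2$, of solutions of this equation.
   Context: For $m\in\mathbb{N}$ and $f\in \mathsf{L}^2(\mathbb{R})$, $A_m f(\xi):=\int_{-m/2}^{m/2} f(\xi+s)\,ds$ (convolution with $\chi_{[-m/2,m/2]}$). The equation is the traveling wave equation for the lattice $\ddot x_j=\sum_{m\ge1}\big(\Phi_m'(x_{j+m}-x_j)-\Phi_m'(x_j-x_{j-m})\big)$ under the ansatz $x_j(t)=\nu j-X(j-ct)$, $W=\dot X$. Standing assumptions on the potentials: for every $m\in\mathbb{N}$, $\Phi_m:[0,\infty)\to[0,\infty)$ is in $C^4([0,\infty))$ with $\Phi_m\ge0$, $\Phi_m'\le0$, $\Phi_m''\ge0$, $\Phi_m'''\le0$, $\Phi_m^{(4)}\ge0$ on $[0,\infty)$, these inequalities being strict for $m=1$ and $s>0$; moreover, for a fixed $\gamma\in(5/2,3)$, $\sum_{m\ge1}\Phi_m'(\nu m-\sqrt{2Km})\,m$ converges (is finite), $\sum_{m\ge1}\Phi_m''(\nu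 m-\sqrt{2Km})\,m^2<\infty$, $\sum_{m\ge1}\Phi_m''(\nu m)\,m^{\gamma}<\infty$, $\sum_{m\ge1}\Phi_m'''(\nu m-\sqrt{2Km})\,m^{3/2}$ converges (is finite). *)

theory Defs
  imports "HOL-Analysis.Analysis"
begin

definition L2R :: "(real \<Rightarrow> real) set" where
  "L2R = {f. f \<in> borel_measurable lborel \<and> integrable lborel (\<lambda>x. (f x)\<^sup>2)}"

definition L2norm_sq :: "(real \<Rightarrow> real) \<Rightarrow> real" where
  "L2norm_sq f = (LINT x|lborel. (f x)\<^sup>2)"

definition Aop :: "nat \<Rightarrow> (real \<Rightarrow> real) \<Rightarrow> real \<Rightarrow> real" where
  "Aop m f \<xi> = (LBINT s=-(real m / 2)..real m / 2. f (\<xi> + s))"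

end

theory Submission
  imports Defs "HOL-Library.Diagonal_Subsequence"
begin

text \<open>
  Put \<open>G\<^sub>m(u) = \<Phi>\<^sub>m(\<nu> m - u) - \<Phi>\<^sub>m(\<nu> m) + \<Phi>\<^sub>m'(\<nu> m) u\<close> and maximise \<open>P W = \<Sum>\<^sub>m \<integral> G\<^sub>m(A\<^sub>m W)\<close> over
  the even, nonnegative functions that decrease on the positive half-line and have squared norm \<open>2K\<close>.
  Long boxes of width \<open>2L\<close> lose at most \<open>O(L powr (2 - \<gamma>))\<close> against the supremum \<open>c\<^sub>0 K\<close>
  of the quadratic part of \<open>P\<close> but gain a multiple of \<open>L powr (-1/2)\<close> from the cubic part of \<open>G\<^sub>1\<close>, so
  \<open>sup P > c\<^sub>0 K\<close>. A maximising sequence converges almost everywhere along a subsequence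
  (Helly); mass escaping to infinity only contributes quadratically, that is at most \<open>c\<^sub>0/2\<close> per unit
  of squared norm, and since \<open>P (s W) \<ge> s\<^sup>2 P W\<close> for \<open>s \<ge> 1\<close>, nothing escapes and the limit \<open>W\<close> is a
  maximiser. Finally \<open>U = \<Sum>\<^sub>m A\<^sub>m G\<^sub>m'(A\<^sub>m W)\<close> has the same symmetry and monotonicity, and by convexity
  \<open>\<langle>U, V\<rangle> \<le> \<langle>U, W\<rangle>\<close> for every admissible \<open>V\<close>; taking \<open>V\<close> proportional to \<open>U\<close>, the equality case of
  Cauchy-Schwarz makes \<open>W\<close> a positive multiple of \<open>U\<close>. The constant \<open>\<eta>\<close> absorbs the terms \<open>m \<Phi>\<^sub>m'(\<nu> m)\<close>.
\<close>

section \<open>Even unimodal functions and squared norms\<close>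

text \<open>Only nonnegativity is asked of the value at 0, so almost everywhere limits may be given
  any nonnegative value there.\<close>

definition unimodal :: "(real \<Rightarrow> real) \<Rightarrow> bool" where
  "unimodal W \<longleftrightarrow> (\<forall>x. W (- x) = W x) \<and> (\<forall>x. 0 \<le> W x) \<and> (\<forall>x y. 0 < x \<longrightarrow> x \<le> y \<longrightarrow> W y \<le> W x)"

lemma unimodalI:
  assumes "\<And>x. W (- x) = W x" "\<And>x. 0 \<le> W x" "\<And>x y. 0 < x \<Longrightarrow> x \<le> y \<Longrightarrow> W y \<le> W x"
  shows "unimodal W"
  using assms by (auto simp: unimodal_def)

lemma unimodal_minus: "unimodal W \<Longrightarrow> W (- x) = W x"
  and unimodal_nonneg: "unimodal W \<Longrightarrow> 0 \<le> W x"
  and unimodal_antimono: "unimodal W \<Longrightarrow> 0 < x \<Longrightarrow> x \<le> y \<Longrightarrow> W y \<le> W x"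
  by (auto simp: unimodal_def)

lemma unimodal_abs: "unimodal W \<Longrightarrow> W \<bar>x\<bar> = W x"
  by (auto simp: unimodal_minus abs_if)

lemma unimodal_abs_le: "unimodal W \<Longrightarrow> x \<noteq> 0 \<Longrightarrow> \<bar>x\<bar> \<le> \<bar>y\<bar> \<Longrightarrow> W y \<le> W x"
  by (metis unimodal_abs unimodal_antimono zero_less_abs_iff)

text \<open>\<open>- W\<close> is monotone on the positive half-line; evenness gives the negative
  half-line, and 0 is added as a separate point.\<close>

lemma unimodal_measurable:
  assumes W: "unimodal W"
  shows "W \<in> borel_measurable borel"
proof -
  have "mono_on {0<..} (\<lambda>x. - W x)"
    using W by (auto simp: mono_on_def intro: unimodal_antimono)
  from borel_measurable_mono_on_fnc[OF this]
  have "(\<lambda>x. - W x) \<in> borel_measurable (restrict_space borel {0<..})" .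
  then have "(\<lambda>x. indicator {0<..} x *\<^sub>R (- W x)) \<in> borel_measurable borel"
    by (subst borel_measurable_restrict_space_iff[symmetric]) auto
  then have *: "(\<lambda>x. - (indicator {0<..} \<bar>x\<bar> *\<^sub>R (- W \<bar>x\<bar>)) + indicator {0} x * W 0) \<in> borel_measurable borel"
    by measurable
  have "W = (\<lambda>x. - (indicator {0<..} \<bar>x\<bar> *\<^sub>R (- W \<bar>x\<bar>)) + indicator {0} x * W 0)"
    using unimodal_abs[OF W] by (auto simp: indicator_def fun_eq_iff)
  with * show ?thesis by simp
qed

section \<open>Square-integrable functions and the Cauchy-Schwarz inequality\<close>

lemma L2R_measurable: "W \<in> L2R \<Longrightarrow> W \<in> borel_measurable borel"
  and L2R_integrable: "W \<in> L2R \<Longrightarrow> integrable lborel (\<lambda>x. (W x)\<^sup>2)"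
  by (auto simp: L2R_def)

lemma L2norm_sq_nonneg: "0 \<le> L2norm_sq W"
  by (simp add: L2norm_sq_def)

lemma L2norm_sq_nn: "W \<in> L2R \<Longrightarrow> (\<integral>\<^sup>+x. ennreal ((W x)\<^sup>2) \<partial>lborel) = ennreal (L2norm_sq W)"
  by (simp add: L2R_def L2norm_sq_def nn_integral_eq_integral)

lemma L2R_I_nn:
  assumes [measurable]: "W \<in> borel_measurable borel"
    and le: "(\<integral>\<^sup>+x. ennreal ((W x)\<^sup>2) \<partial>lborel) \<le> ennreal b" and b: "0 \<le> b"
  shows "W \<in> L2R" "L2norm_sq W \<le> b"
proof -
  have "integrable lborel (\<lambda>x. (W x)\<^sup>2)"
    using le by (intro integrableI_bounded) (auto simp: less_top[symmetric] top_unique)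
  then show W: "W \<in> L2R" by (simp add: L2R_def)
  show "L2norm_sq W \<le> b"
    using le b L2norm_sq_nn[OF W] by simp
qed

lemma L2R_mult_integrable:
  assumes "U \<in> L2R" "V \<in> L2R"
  shows "integrable lborel (\<lambda>x. U x * V x)"
proof (rule Bochner_Integration.integrable_bound)
  note [measurable] = assms[THEN L2R_measurable]
  show "integrable lborel (\<lambda>x. (U x)\<^sup>2 + (V x)\<^sup>2)"
    using assms by (auto simp: L2R_integrable)
  show "(\<lambda>x. U x * V x) \<in> borel_measurable lborel" by measurable
  have "\<bar>u * v\<bar> \<le> u\<^sup>2 + v\<^sup>2" for u v :: real
    using sum_squares_bound[of "\<bar>u\<bar>" "\<bar>v\<bar>"] abs_mult[of u v] abs_ge_zero[of "u * v"]
    unfolding power2_abs by linarith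
  then show "AE x in lborel. norm (U x * V x) \<le> norm ((U x)\<^sup>2 + (V x)\<^sup>2)"
    by auto
qed

text \<open>The squared norm of \<open>s U + t V\<close> is a nonnegative quadratic form in
  \<open>s\<close> and \<open>t\<close>; at \<open>s = L2norm_sq V\<close>, \<open>t = - I\<close>
  it is the claim up to a factor \<open>L2norm_sq V\<close>.\<close>

lemma L2_Cauchy_Schwarz:
  assumes "U \<in> L2R" "V \<in> L2R"
  shows "(\<integral>x. U x * V x \<partial>lborel)\<^sup>2 \<le> L2norm_sq U * L2norm_sq V"
proof -
  note i [simp] = L2R_mult_integrable[OF assms] assms[THEN L2R_integrable]
  have q: "0 \<le> s\<^sup>2 * L2norm_sq U + 2 * s * t * (\<integral>x. U x * V x \<partial>lborel) + t\<^sup>2 * L2norm_sq V" for s t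
  proof -
    have "0 \<le> (\<integral>x. (s * U x + t * V x)\<^sup>2 \<partial>lborel)" by simp
    also have "\<dots> = (\<integral>x. s\<^sup>2 * (U x)\<^sup>2 + 2 * s * t * (U x * V x) + t\<^sup>2 * (V x)\<^sup>2 \<partial>lborel)"
      by (simp add: power2_eq_square algebra_simps)
    finally show ?thesis by (simp add: L2norm_sq_def)
  qed
  define I where "I = (\<integral>x. U x * V x \<partial>lborel)"
  show ?thesis
  proof (cases "L2norm_sq V = 0")
    case True
    have "I = 0"
    proof (rule ccontr)
      assume "I \<noteq> 0"
      \<comment> \<open>If \<open>V\<close> has norm 0, the form at \<open>s = 1\<close> is affine
        in \<open>t\<close>; this \<open>t\<close> would give it the value -1.\<close>
      moreover have "0 \<le> L2norm_sq U + 2 * (- (L2norm_sq U + 1) / (2 * I)) * I"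
        using q[of 1 "- (L2norm_sq U + 1) / (2 * I)"] True by (simp add: I_def)
      ultimately show False by (simp add: field_simps)
    qed
    then show ?thesis using True by (simp add: I_def)
  next
    case False
    then have V: "0 < L2norm_sq V" using L2norm_sq_nonneg[of V] by simp
    have "0 \<le> (L2norm_sq V) * (L2norm_sq U * L2norm_sq V - I\<^sup>2)"
      using q[of "L2norm_sq V" "- I"] by (simp add: I_def power2_eq_square algebra_simps)
    then show ?thesis using V by (simp add: I_def zero_le_mult_iff)
  qed
qed

section \<open>The averaging operators\<close>

abbreviation win :: "nat \<Rightarrow> real \<Rightarrow> real set" where
  "win m x \<equiv> {x - real m / 2<..<x + real m / 2}"

text \<open>Substituting \<open>t = x + s\<close> exhibits an integral operator whose kernel is
  symmetric in \<open>x\<close> and \<open>t\<close>, the form in which Tonelli and Cauchy-Schwarz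
  apply.\<close>

lemma Aop_eq: "Aop m f x = (\<integral>t. indicator (win m x) t * f t \<partial>lborel)"
proof -
  have "Aop m f x = (\<integral>s. indicator {-(real m / 2)<..<real m / 2} s * f (x + s) \<partial>lborel)"
    by (simp add: Aop_def interval_lebesgue_integral_def set_lebesgue_integral_def einterval_eq)
  also have "\<dots> = (\<integral>s. indicator (win m x) (x + 1 * s) * f (x + 1 * s) \<partial>lborel)"
    by (intro Bochner_Integration.integral_cong refl) (auto simp: indicator_def)
  also have "\<dots> = (\<integral>t. indicator (win m x) t * f t \<partial>lborel)"
    by (subst lborel_integral_real_affine[of 1 _ x]) auto
  finally show ?thesis .
qed

lemma indicator_win_L2R: "(\<lambda>t. indicator (win m x) t) \<in> L2R"
  and L2norm_sq_win: "L2norm_sq (\<lambda>t. indicator (win m x) t) = real m"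
proof -
  have "(\<lambda>t. (indicator (win m x) t :: real)\<^sup>2) = indicator (win m x)"
    by (auto simp: indicator_def fun_eq_iff)
  then show "(\<lambda>t. indicator (win m x) t) \<in> L2R" "L2norm_sq (\<lambda>t. indicator (win m x) t) = real m"
    by (auto simp: L2R_def L2norm_sq_def)
qed

lemma L2R_win_integrable: "W \<in> L2R \<Longrightarrow> integrable lborel (\<lambda>t. indicator (win m x) t * W t)"
  by (rule L2R_mult_integrable[OF indicator_win_L2R])

lemma L2R_restrict:
  assumes W: "W \<in> L2R" and [measurable]: "A \<in> sets borel"
  shows "(\<lambda>t. indicator A t * W t) \<in> L2R"
proof -
  note [measurable] = L2R_measurable[OF W]
  have "integrable lborel (\<lambda>t. (indicator A t * W t)\<^sup>2)"
    by (rule Bochner_Integration.integrable_bound[OF L2R_integrable[OF W]])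
      (auto simp: indicator_def)
  then show ?thesis by (auto simp: L2R_def)
qed

text \<open>Cauchy-Schwarz against the window indicator, whose squared norm is \<open>m\<close>.
  Restricting \<open>W\<close> to the window first leaves only local mass on the right, so the bound
  can later be integrated in \<open>x\<close>.\<close>

lemma Aop_sq_le:
  assumes W: "W \<in> L2R"
  shows "(Aop m W x)\<^sup>2 \<le> real m * (\<integral>t. indicator (win m x) t * (W t)\<^sup>2 \<partial>lborel)"
proof -
  have W': "(\<lambda>t. indicator (win m x) t * W t) \<in> L2R"
    by (rule L2R_restrict[OF W]) auto
  have "Aop m W x = (\<integral>t. indicator (win m x) t * (indicator (win m x) t * W t) \<partial>lborel)"
    unfolding Aop_eq by (intro Bochner_Integration.integral_cong) (auto simp: indicator_def)
  moreover have "L2norm_sq (\<lambda>t. indicator (win m x) t * W t) = (\<integral>t. indicator (win m x) t * (W t)\<^sup>2 \<partial>lborel)"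
    unfolding L2norm_sq_def by (intro Bochner_Integration.integral_cong) (auto simp: indicator_def)
  ultimately show ?thesis
    using L2_Cauchy_Schwarz[OF indicator_win_L2R W'] by (simp only: L2norm_sq_win)
qed

lemma Aop_abs_le:
  assumes W: "W \<in> L2R"
  shows "\<bar>Aop m W x\<bar> \<le> sqrt (real m * L2norm_sq W)"
proof (rule real_le_rsqrt)
  have "(\<integral>t. indicator (win m x) t * (W t)\<^sup>2 \<partial>lborel) \<le> L2norm_sq W"
    unfolding L2norm_sq_def
  proof (rule integral_mono)
    show "integrable lborel (\<lambda>t. indicator (win m x) t * (W t)\<^sup>2)"
      using integrable_mult_indicator[OF _ L2R_integrable[OF W], of "win m x"] by simp
  qed (auto simp: L2R_integrable[OF W] indicator_def)
  then show "\<bar>Aop m W x\<bar>\<^sup>2 \<le> real m * L2norm_sq W"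
    using Aop_sq_le[OF W, of m x] by (simp add: mult_left_mono order_trans)
qed

lemma Aop_measurable:
  assumes [measurable]: "f \<in> borel_measurable borel"
  shows "Aop m f \<in> borel_measurable borel"
proof -
  \<comment> \<open>Writing the moving indicator as \<open>of_bool\<close> makes joint measurability
    in \<open>x\<close> and \<open>t\<close> visible.\<close>
  have "(\<lambda>x. \<integral>t. of_bool (x - real m / 2 < t \<and> t < x + real m / 2) * f t \<partial>lborel) \<in> borel_measurable borel"
    by measurable
  also have "(\<lambda>x. \<integral>t. of_bool (x - real m / 2 < t \<and> t < x + real m / 2) * f t \<partial>lborel) = Aop m f"
    unfolding Aop_eq fun_eq_iff
    by (intro allI Bochner_Integration.integral_cong) (auto simp: indicator_def)
  finally show ?thesis .
qed

text \<open>Tonelli's theorem, since \<open>t\<close> lies in the window around \<open>x\<close>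
  exactly when \<open>x\<close> lies in the window around \<open>t\<close>.\<close>

lemma nn_integral_win_swap:
  assumes [measurable]: "f \<in> borel_measurable borel" "h \<in> borel_measurable borel"
  shows "(\<integral>\<^sup>+x. h x * (\<integral>\<^sup>+t. indicator (win m x) t * f t \<partial>lborel) \<partial>lborel)
       = (\<integral>\<^sup>+t. f t * (\<integral>\<^sup>+x. indicator (win m t) x * h x \<partial>lborel) \<partial>lborel)"
proof -
  define k :: "real \<Rightarrow> real \<Rightarrow> ennreal"
    where "k x t = of_bool (x - real m / 2 < t \<and> t < x + real m / 2)" for x t
  have k: "indicator (win m x) t = k x t" "indicator (win m t) x = k x t" for x t
    by (auto simp: k_def indicator_def)
  have [measurable]: "(\<lambda>(x,t). k x t) \<in> borel_measurable (borel \<Otimes>\<^sub>M borel)"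
    unfolding k_def by measurable
  have "(\<integral>\<^sup>+x. h x * (\<integral>\<^sup>+t. k x t * f t \<partial>lborel) \<partial>lborel)
      = (\<integral>\<^sup>+x. (\<integral>\<^sup>+t. h x * (k x t * f t) \<partial>lborel) \<partial>lborel)"
    by (subst nn_integral_cmult) auto
  also have "\<dots> = (\<integral>\<^sup>+t. (\<integral>\<^sup>+x. h x * (k x t * f t) \<partial>lborel) \<partial>lborel)"
    by (rule lborel_pair.Fubini') measurable
  also have "\<dots> = (\<integral>\<^sup>+t. (\<integral>\<^sup>+x. f t * (k x t * h x) \<partial>lborel) \<partial>lborel)"
    by (simp add: ac_simps)
  also have "\<dots> = (\<integral>\<^sup>+t. f t * (\<integral>\<^sup>+x. k x t * h x \<partial>lborel) \<partial>lborel)"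
    by (subst nn_integral_cmult) auto
  moreover have "(\<integral>\<^sup>+x. h x * (\<integral>\<^sup>+t. indicator (win m x) t * f t \<partial>lborel) \<partial>lborel) =
    (\<integral>\<^sup>+x. h x * (\<integral>\<^sup>+t. k x t * f t \<partial>lborel) \<partial>lborel)"
    by (simp only: k(1))
  moreover have "(\<integral>\<^sup>+t. f t * (\<integral>\<^sup>+x. indicator (win m t) x * h x \<partial>lborel) \<partial>lborel) =
    (\<integral>\<^sup>+t. f t * (\<integral>\<^sup>+x. k x t * h x \<partial>lborel) \<partial>lborel)"
    by (simp only: k(2))
  ultimately show ?thesis by simp
qed

lemma Aop_nn:
  assumes "\<And>t. 0 \<le> f t" and "integrable lborel (\<lambda>t. indicator (win m x) t * f t)"
  shows "ennreal (Aop m f x) = (\<integral>\<^sup>+t. indicator (win m x) t * ennreal (f t) \<partial>lborel)"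
proof -
  have "(\<integral>\<^sup>+t. indicator (win m x) t * ennreal (f t) \<partial>lborel) = (\<integral>\<^sup>+t. ennreal (indicator (win m x) t * f t) \<partial>lborel)"
    by (intro nn_integral_cong) (auto simp: indicator_def)
  then show ?thesis
    using assms by (simp add: Aop_eq nn_integral_eq_integral)
qed

lemma Aop_nonneg: "(\<And>t. 0 \<le> f t) \<Longrightarrow> 0 \<le> Aop m f x"
  unfolding Aop_eq by simp

text \<open>Integrate \<open>Aop_sq_le\<close> in \<open>x\<close>: one factor \<open>m\<close>
  comes from Cauchy-Schwarz, the other from Tonelli, as each \<open>t\<close> is seen from a set of
  centres of length \<open>m\<close>.\<close>

lemma Aop_L2:
  assumes W: "W \<in> L2R"
  shows "Aop m W \<in> L2R" "L2norm_sq (Aop m W) \<le> (real m)\<^sup>2 * L2norm_sq W"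
proof -
  note [measurable] = L2R_measurable[OF W] Aop_measurable[OF L2R_measurable[OF W]]
  have "(\<integral>\<^sup>+x. ennreal ((Aop m W x)\<^sup>2) \<partial>lborel)
      \<le> (\<integral>\<^sup>+x. ennreal m * (\<integral>\<^sup>+t. indicator (win m x) t * ennreal ((W t)\<^sup>2) \<partial>lborel) \<partial>lborel)"
  proof (rule nn_integral_mono)
    fix x
    have i: "integrable lborel (\<lambda>t. indicator (win m x) t * (W t)\<^sup>2)"
      using integrable_mult_indicator[OF _ L2R_integrable[OF W], of "win m x"] by simp
    have "ennreal ((Aop m W x)\<^sup>2) \<le> ennreal (real m * Aop m (\<lambda>t. (W t)\<^sup>2) x)"
      using Aop_sq_le[OF W, of m x] by (intro ennreal_leI) (simp add: Aop_eq)
    then show "ennreal ((Aop m W x)\<^sup>2) \<le> ennreal m * (\<integral>\<^sup>+t. indicator (win m x) t * ennreal ((W t)\<^sup>2) \<partial>lborel)"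
      using Aop_nn[OF _ i] by (simp add: ennreal_mult' Aop_nonneg)
  qed
  also have "\<dots> = (\<integral>\<^sup>+t. ennreal ((W t)\<^sup>2) * (\<integral>\<^sup>+x. indicator (win m t) x * ennreal m \<partial>lborel) \<partial>lborel)"
    by (rule nn_integral_win_swap) auto
  also have "\<dots> = (\<integral>\<^sup>+t. ennreal ((real m)\<^sup>2) * ennreal ((W t)\<^sup>2) \<partial>lborel)"
    by (subst nn_integral_multc) (auto simp: ennreal_mult'[symmetric] ac_simps power2_eq_square)
  also have "\<dots> = ennreal ((real m)\<^sup>2 * L2norm_sq W)"
    by (subst nn_integral_cmult) (auto simp: L2norm_sq_nn[OF W] ennreal_mult')
  finally have le: "(\<integral>\<^sup>+x. ennreal ((Aop m W x)\<^sup>2) \<partial>lborel) \<le> ennreal ((real m)\<^sup>2 * L2norm_sq W)" .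
  show "Aop m W \<in> L2R" "L2norm_sq (Aop m W) \<le> (real m)\<^sup>2 * L2norm_sq W"
    by (rule L2R_I_nn[OF _ le]; simp add: L2norm_sq_nonneg)+
qed

text \<open>Self-adjointness of the average. With nonnegative integrals, integrability of the
  products need not be known beforehand.\<close>

lemma Aop_adjoint:
  assumes [measurable]: "U \<in> borel_measurable borel" "V \<in> borel_measurable borel"
    and nn: "\<And>t. 0 \<le> U t" "\<And>t. 0 \<le> V t"
    and int: "\<And>x. integrable lborel (\<lambda>t. indicator (win m x) t * U t)"
      "\<And>x. integrable lborel (\<lambda>t. indicator (win m x) t * V t)"
  shows "(\<integral>\<^sup>+x. ennreal (Aop m U x * V x) \<partial>lborel) = (\<integral>\<^sup>+x. ennreal (U x * Aop m V x) \<partial>lborel)"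
proof -
  have "(\<integral>\<^sup>+x. ennreal (Aop m U x * V x) \<partial>lborel)
    = (\<integral>\<^sup>+x. ennreal (V x) * (\<integral>\<^sup>+t. indicator (win m x) t * ennreal (U t) \<partial>lborel) \<partial>lborel)"
    by (intro nn_integral_cong) (simp only: mult.commute[of "Aop m U _"] ennreal_mult' nn Aop_nn[OF nn(1) int(1), symmetric])
  also have "\<dots> = (\<integral>\<^sup>+x. ennreal (U x) * (\<integral>\<^sup>+t. indicator (win m x) t * ennreal (V t) \<partial>lborel) \<partial>lborel)"
    by (rule nn_integral_win_swap) auto
  also have "\<dots> = (\<integral>\<^sup>+x. ennreal (U x * Aop m V x) \<partial>lborel)"
    by (intro nn_integral_cong) (simp only: ennreal_mult' nn Aop_nn[OF nn(2) int(2), symmetric])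
  finally show ?thesis .
qed

lemma Aop_mono:
  assumes "\<And>t. f t \<le> g t" "integrable lborel (\<lambda>t. indicator (win m x) t * f t)"
    "integrable lborel (\<lambda>t. indicator (win m x) t * g t)"
  shows "Aop m f x \<le> Aop m g x"
  unfolding Aop_eq using assms by (intro integral_mono mult_left_mono) auto

lemma Aop_const: "Aop m (\<lambda>_. c) x = real m * c"
  by (simp add: Aop_eq)

lemma Aop_cmult: "Aop m (\<lambda>t. c * f t) x = c * Aop m f x"
  by (simp add: Aop_eq mult.left_commute[of _ c])

lemma unimodal_Aop:
  assumes W: "unimodal W" and int: "\<And>x. integrable lborel (\<lambda>t. indicator (win m x) t * W t)"
  shows "unimodal (Aop m W)"
proof (rule unimodalI)
  fix x
  show "0 \<le> Aop m W x" by (intro Aop_nonneg unimodal_nonneg[OF W])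
  have "Aop m W (- x) = (\<integral>t. indicator (win m (-x)) (0 + (-1) * t) * W (0 + (-1) * t) \<partial>lborel)"
    unfolding Aop_eq by (subst lborel_integral_real_affine[of "-1" _ 0]) auto
  also have "\<dots> = Aop m W x"
    unfolding Aop_eq by (intro Bochner_Integration.integral_cong) (auto simp: indicator_def unimodal_minus[OF W])
  finally show "Aop m W (- x) = Aop m W x" .
next
  fix x y :: real assume xy: "0 < x" "x \<le> y"
  let ?r = "\<lambda>t. x + y - t"
  \<comment> \<open>The reflection \<open>?r\<close> exchanges the windows around \<open>x\<close> and \<open>y\<close>; antisymmetrising makes the integrand of the difference nonnegative.\<close>
  have refl: "(\<integral>t. f t \<partial>lborel) = (\<integral>t. f (?r t) \<partial>lborel)" for f :: "real \<Rightarrow> real"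
    by (subst lborel_integral_real_affine[of "-1" f "x + y"]) auto
  have irefl: "integrable lborel f \<Longrightarrow> integrable lborel (\<lambda>t. f (?r t))" for f :: "real \<Rightarrow> real"
    using lborel_integrable_real_affine[of f "-1" "x + y"] by simp
  have wr: "indicator (win m y) (?r t) = (indicator (win m x) t :: real)"
    "indicator (win m x) (?r t) = (indicator (win m y) t :: real)" for t
    by (auto simp: indicator_def)
  have i: "integrable lborel (\<lambda>t. indicator (win m x) t * W t)" "integrable lborel (\<lambda>t. indicator (win m y) t * W t)"
    "integrable lborel (\<lambda>t. indicator (win m y) t * W (?r t))" "integrable lborel (\<lambda>t. indicator (win m x) t * W (?r t))"
    using int[of x] int[of y] irefl[OF int[of x]] irefl[OF int[of y]] by (auto simp: wr)
  have "2 * (Aop m W x - Aop m W y) = (\<integral>t. indicator (win m x) t * W t \<partial>lborel) - (\<integral>t. indicator (win m y) t * W t \<partial>lborel)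
     + ((\<integral>t. indicator (win m y) t * W (?r t) \<partial>lborel) - (\<integral>t. indicator (win m x) t * W (?r t) \<partial>lborel))"
    using refl[of "\<lambda>t. indicator (win m x) t * W t"] refl[of "\<lambda>t. indicator (win m y) t * W t"]
    by (simp add: wr Aop_eq)
  also have "\<dots> = (\<integral>t. (indicator (win m x) t - indicator (win m y) t) * (W t - W (?r t)) \<partial>lborel)"
    using i by (simp add: Bochner_Integration.integral_diff[symmetric] Bochner_Integration.integral_add[symmetric] algebra_simps
      del: Bochner_Integration.integral_diff Bochner_Integration.integral_add)
  also have "\<dots> \<ge> 0"
  proof (rule integral_nonneg_AE)
    \<comment> \<open>\<open>unimodal\<close> does not compare the value at 0 with the others, so
      these two points are set aside.\<close>
    have "AE t in lborel. t \<noteq> 0 \<and> ?r t \<noteq> 0"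
      using AE_lborel_singleton[of 0] AE_lborel_singleton[of "x + y"] by eventually_elim auto
    then show "AE t in lborel. 0 \<le> (indicator (win m x) t - indicator (win m y) t) * (W t - W (?r t))"
    proof eventually_elim
      case (elim t)
      show ?case
      \<comment> \<open>The midpoint of \<open>t\<close> and \<open>?r t\<close> is positive, so the
        smaller of them is also smaller in modulus. If that is \<open>t\<close>, it is at least as
        near to \<open>x\<close> as to \<open>y\<close> and both factors are nonnegative; otherwise
        both are nonpositive.\<close>
      proof (cases "t \<le> ?r t")
        case True
        then have "W (?r t) \<le> W t"
          using elim xy by (intro unimodal_abs_le[OF W]) auto
        moreover have "(indicator (win m y) t :: real) \<le> indicator (win m x) t"
          using True xy by (auto simp: indicator_def)
        ultimately show ?thesis by simp
      next
        case False
        then have "W t \<le> W (?r t)"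
          using elim xy by (intro unimodal_abs_le[OF W]) auto
        moreover have "(indicator (win m x) t :: real) \<le> indicator (win m y) t"
          using False xy by (auto simp: indicator_def)
        ultimately show ?thesis by (simp add: mult_nonpos_nonpos)
      qed
    qed
  qed
  finally show "Aop m W y \<le> Aop m W x" by simp
qed

text \<open>On the interval of length \<open>2 * \<bar>x\<bar>\<close> around 0 the function is
  almost everywhere at least \<open>W x\<close>, which costs mass
  \<open>2 * \<bar>x\<bar> * (W x)\<^sup>2\<close>.\<close>

lemma unimodal_bound:
  assumes W: "unimodal W" and L2: "W \<in> L2R" and x: "x \<noteq> 0"
  shows "W x \<le> sqrt (L2norm_sq W / (2 * \<bar>x\<bar>))"
proof (rule real_le_rsqrt)
  have "AE t in lborel. indicator {-\<bar>x\<bar>..\<bar>x\<bar>} t * (W x)\<^sup>2 \<le> (W t)\<^sup>2"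
    using AE_lborel_singleton[of 0]
  proof eventually_elim
    case (elim t)
    then show ?case
      using unimodal_abs_le[OF W, of t x] unimodal_nonneg[OF W, of x]
      by (auto simp: indicator_def intro!: power_mono)
  qed
  then have "(\<integral>t. indicator {-\<bar>x\<bar>..\<bar>x\<bar>} t * (W x)\<^sup>2 \<partial>lborel) \<le> L2norm_sq W"
    unfolding L2norm_sq_def by (intro integral_mono_AE L2R_integrable[OF L2]) auto
  then show "(W x)\<^sup>2 \<le> L2norm_sq W / (2 * \<bar>x\<bar>)"
    using x by (simp add: field_simps)
qed

section \<open>Pointwise convergence\<close>

text \<open>Helly's selection theorem. A diagonal subsequence converges at all positive rationals,
  its limit extends to a decreasing function with countably many discontinuities, and monotonicity
  forces convergence elsewhere.\<close>

lemma antimono_selection: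
  fixes f :: "nat \<Rightarrow> real \<Rightarrow> real" and B :: "real \<Rightarrow> real"
  assumes mono: "\<And>n x y. 0 < x \<Longrightarrow> x \<le> y \<Longrightarrow> f n y \<le> f n x"
    and bdd: "\<And>n x. 0 < x \<Longrightarrow> 0 \<le> f n x \<and> f n x \<le> B x"
  shows "\<exists>s F. strict_mono (s :: nat \<Rightarrow> nat) \<and> (\<forall>x>0. 0 \<le> F x) \<and> (\<forall>x y. 0 < x \<longrightarrow> x \<le> y \<longrightarrow> F y \<le> F x) \<and>
    countable {x \<in> {0<..}. \<not> (\<lambda>n. f (s n) x) \<longlonglongrightarrow> F x}"
proof -
  define Q where "Q = \<rat> \<inter> {0::real<..}"
  have "countable Q" unfolding Q_def using countable_rat by blast
  have dense: "\<exists>q\<in>Q. x < q \<and> q < y" if "0 \<le> x" "x < y" for x y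
    using Rats_dense_in_real[OF that(2)] that(1) by (auto simp: Q_def)
  define r where "r = from_nat_into Q"
  have "Q \<noteq> {}" using dense[of 0 1] by auto
  have r_range: "range r = Q"
    unfolding r_def using \<open>Q \<noteq> {}\<close> \<open>countable Q\<close> by (rule range_from_nat_into)
  then have r_pos: "0 < r n" for n
    by (auto simp: Q_def)
  let ?P = "\<lambda>n s. convergent (\<lambda>k. f (s k) (r n))"
  interpret subseqs ?P
  proof
    fix n :: nat and s :: "nat \<Rightarrow> nat" assume "strict_mono s"
    have "f (s k) (r n) \<in> {0..B (r n)}" for k
      using bdd[OF r_pos] by simp
    then obtain l s' where "strict_mono (s' :: nat \<Rightarrow> nat)" "((\<lambda>k. f (s k) (r n)) \<circ> s') \<longlonglongrightarrow> l"
      by (meson compact_Icc compact_imp_seq_compact seq_compactE)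
    then show "\<exists>s'. strict_mono s' \<and> ?P n (s \<circ> s')"
      by (auto simp: convergent_def comp_def)
  qed
  define s where "s = diagseq"
  have subseq: "strict_mono s"
    unfolding s_def using subseq_diagseq by auto
  have cnv: "?P n s" for n
  proof -
    \<comment> \<open>The diagonal sequence refines the selection made for \<open>r n\<close> only
      after its first \<open>Suc n\<close> terms, which convergence ignores.\<close>
    have "?P n (s \<circ> ((+) (Suc n)))"
      unfolding s_def
    proof (rule diagseq_holds)
      fix n :: nat and s t :: "nat \<Rightarrow> nat"
      assume "strict_mono t" "?P n s"
      then show "?P n (s \<circ> t)"
        using convergent_subseq_convergent[of "\<lambda>k. f (s k) (r n)" t] by (simp add: comp_def)
    qed
    then show ?thesis
      using convergent_ignore_initial_segment[of "\<lambda>k. f (s k) (r n)" "Suc n"]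
      by (simp add: comp_def add.commute)
  qed
  define L where "L q = lim (\<lambda>k. f (s k) q)" for q
  have L: "(\<lambda>k. f (s k) q) \<longlonglongrightarrow> L q" if "q \<in> Q" for q
    using cnv that r_range unfolding L_def by (auto simp: convergent_LIMSEQ_iff)
  have L_nonneg: "0 \<le> L q" if "q \<in> Q" for q
    using that by (intro LIMSEQ_le_const[OF L[OF that]]) (auto simp: bdd Q_def)
  \<comment> \<open>As the infimum runs over rationals strictly to the left, the upper estimate
    below holds at every positive \<open>x\<close>; only the lower one uses continuity of
    \<open>F\<close>.\<close>
  define F where "F x = Inf (L ` {q \<in> Q. q < x})" for x
  have ne: "L ` {q \<in> Q. q < x} \<noteq> {}" if "0 < x" for x
    using dense[of 0 x] that by auto
  have bb: "bdd_below (L ` {q \<in> Q. q < x})" for x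
    using L_nonneg by (auto intro!: bdd_belowI[of _ 0])
  have F_nonneg: "0 \<le> F x" if "0 < x" for x
    unfolding F_def using ne[OF that] L_nonneg by (auto intro!: cInf_greatest)
  have F_anti: "F y \<le> F x" if "0 < x" "x \<le> y" for x y
    unfolding F_def using ne[OF that(1)] bb that by (intro cInf_superset_mono) auto
  have conv: "(\<lambda>n. f (s n) x) \<longlonglongrightarrow> F x" if x: "0 < x" and cont: "continuous (at x within {0<..}) F" for x
  proof (rule order_tendstoI)
    fix a assume "a < F x"
    with cont have "\<forall>\<^sub>F y in at x within {0<..}. a < F y"
      unfolding continuous_within by (rule order_tendstoD(1))
    then obtain d where d: "d > 0" "\<And>y. 0 < y \<Longrightarrow> y \<noteq> x \<Longrightarrow> dist y x < d \<Longrightarrow> a < F y"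
      unfolding eventually_at by auto
    \<comment> \<open>Between \<open>x\<close> and a \<open>y\<close> with \<open>a < F y\<close>
      there is a rational \<open>q\<close>; then \<open>F y \<le> L q\<close>, and the values at
      \<open>x\<close> dominate those at \<open>q\<close>.\<close>
    define y where "y = x + d / 2"
    have y: "x < y" "a < F y" using d x by (auto simp: y_def dist_real_def)
    obtain q where q: "q \<in> Q" "x < q" "q < y" using dense[of x y] x y by auto
    have "F y \<le> L q" unfolding F_def using q by (intro cInf_lower bb) auto
    with y have "a < L q" by simp
    then have "\<forall>\<^sub>F n in sequentially. a < f (s n) q"
      using L[OF q(1)] by (simp add: order_tendstoD)
    then show "\<forall>\<^sub>F n in sequentially. a < f (s n) x"
    proof eventually_elim
      case (elim n)
      then show ?case using mono[of x q "s n"] x q by simp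
    qed
  next
    fix a assume "F x < a"
    then obtain q where q: "q \<in> Q" "q < x" "L q < a"
      unfolding F_def using cInf_less_iff[OF ne[OF x] bb] by auto
    then have "\<forall>\<^sub>F n in sequentially. f (s n) q < a"
      using L[OF q(1)] by (simp add: order_tendstoD)
    then show "\<forall>\<^sub>F n in sequentially. f (s n) x < a"
    proof eventually_elim
      case (elim n)
      then show ?case using mono[of q x "s n"] q by (auto simp: Q_def)
    qed
  qed
  have "mono_on {0<..} (\<lambda>x. - F x)"
    by (auto simp: mono_on_def intro: F_anti)
  from mono_on_ctble_discont[OF this]
  have "countable {x \<in> {0<..}. \<not> continuous (at x within {0<..}) (\<lambda>x. - F x)}" .
  then have "countable {x \<in> {0<..}. \<not> (\<lambda>n. f (s n) x) \<longlonglongrightarrow> F x}"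
  proof (rule countable_subset[rotated], safe)
    fix x :: real
    assume "0 < x" "\<not> (\<lambda>n. f (s n) x) \<longlonglongrightarrow> F x" "continuous (at x within {0<..}) (\<lambda>x. - F x)"
    then show False
      using conv[of x] continuous_minus[of "at x within {0<..}" "\<lambda>x. - F x"] by simp
  qed
  with subseq F_nonneg F_anti show ?thesis by blast
qed

text \<open>\<open>unimodal_bound\<close> supplies the pointwise bound for Helly's theorem on the
  positive half-line; evenness transports the limit, and the exceptional set is countable, hence
  null.\<close>

lemma unimodal_selection:
  assumes W: "\<And>n. unimodal (W n)" and L2: "\<And>n. W n \<in> L2R" and N: "\<And>n. L2norm_sq (W n) \<le> N"
  shows "\<exists>s V. strict_mono (s :: nat \<Rightarrow> nat) \<and> unimodal V \<and> (AE x in lborel. (\<lambda>n. W (s n) x) \<longlonglongrightarrow> V x)"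
proof -
  have bd: "0 \<le> W n x \<and> W n x \<le> sqrt (N / (2 * \<bar>x\<bar>))" if "0 < x" for n x
  proof
    have "W n x \<le> sqrt (L2norm_sq (W n) / (2 * \<bar>x\<bar>))"
      using that by (intro unimodal_bound[OF W L2]) auto
    also have "\<dots> \<le> sqrt (N / (2 * \<bar>x\<bar>))"
      by (intro real_sqrt_le_mono divide_right_mono N) simp
    finally show "W n x \<le> sqrt (N / (2 * \<bar>x\<bar>))" .
  qed (rule unimodal_nonneg[OF W])
  have "\<exists>s F. strict_mono (s :: nat \<Rightarrow> nat) \<and> (\<forall>x>0. 0 \<le> F x) \<and> (\<forall>x y. 0 < x \<longrightarrow> x \<le> y \<longrightarrow> F y \<le> F x) \<and>
    countable {x \<in> {0<..}. \<not> (\<lambda>n. W (s n) x) \<longlonglongrightarrow> F x}"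
    by (rule antimono_selection[OF unimodal_antimono[OF W] bd])
  then obtain s F where sel: "strict_mono (s :: nat \<Rightarrow> nat) \<and> (\<forall>x>0. 0 \<le> F x) \<and>
    (\<forall>x y. 0 < x \<longrightarrow> x \<le> y \<longrightarrow> F y \<le> F x) \<and> countable {x \<in> {0<..}. \<not> (\<lambda>n. W (s n) x) \<longlonglongrightarrow> F x}"
    (is "_ \<and> _ \<and> _ \<and> countable ?C")
    by (elim exE)
  then have s: "strict_mono s" and F0: "\<And>x. 0 < x \<Longrightarrow> 0 \<le> F x"
    and Fm: "\<And>x y. 0 < x \<Longrightarrow> x \<le> y \<Longrightarrow> F y \<le> F x" and c: "countable ?C"
    by simp_all
  define C where "C = ?C"
  \<comment> \<open>The value at 0 is a convention; the point 0 goes into the exceptional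
    set.\<close>
  define V where "V x = (if x = 0 then 0 else F \<bar>x\<bar>)" for x
  have "unimodal V"
    by (rule unimodalI) (auto simp: V_def F0 intro: Fm)
  moreover have "AE x in lborel. (\<lambda>n. W (s n) x) \<longlonglongrightarrow> V x"
  proof (rule AE_I')
    have "countable ({0} \<union> C \<union> uminus ` C)"
      by (intro countable_Un countable_image c[folded C_def]) simp
    then show "{0} \<union> C \<union> uminus ` C \<in> null_sets lborel"
      by (rule countable_imp_null_set_lborel)
    show "{x \<in> space lborel. \<not> (\<lambda>n. W (s n) x) \<longlonglongrightarrow> V x} \<subseteq> {0} \<union> C \<union> uminus ` C"
    proof
      fix x assume x: "x \<in> {x \<in> space lborel. \<not> (\<lambda>n. W (s n) x) \<longlonglongrightarrow> V x}"
      then have "x = 0 \<or> \<bar>x\<bar> \<in> C" by (cases "x = 0") (simp_all add: C_def V_def unimodal_abs[OF W])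
      moreover have "x = \<bar>x\<bar> \<or> x = - \<bar>x\<bar>" by linarith
      ultimately show "x \<in> {0} \<union> C \<union> uminus ` C"
        by (metis UnI1 UnI2 imageI singletonI)
    qed
  qed
  ultimately show ?thesis using s by meson
qed

text \<open>The bound of \<open>unimodal_bound\<close> has this singularity at 0; its local
  integrability makes it the dominating function in \<open>Aop_tendsto\<close>.\<close>

lemma integrable_inverse_sqrt_win: "integrable lborel (\<lambda>t. indicator (win m x) t * sqrt (c / \<bar>t\<bar>))"
proof -
  define R where "R = \<bar>x\<bar> + real m"
  have R: "0 \<le> R" by (simp add: R_def)
  have "((\<lambda>t. t powr (-1/2)) has_integral (R powr (-1/2 + 1) / (-1/2 + 1))) {0..R}"
    using has_integral_powr_from_0[of "-1/2" R] R by simp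
  then have "(\<lambda>t. t powr (-1/2)) absolutely_integrable_on {0..R}"
    by (intro nonnegative_absolutely_integrable_1) (auto simp: integrable_on_def)
  then have "integrable lborel (\<lambda>t. indicator {0..R} t *\<^sub>R (t powr (-1/2)))"
    unfolding set_integrable_def by (subst (asm) integrable_completion) auto
  then have 1: "integrable lborel (\<lambda>t. indicator {0..R} t * t powr (-1/2))" by simp
  have 2: "integrable lborel (\<lambda>t. indicator {0..R} (- t) * (- t) powr (-1/2))"
    using lborel_integrable_real_affine[OF 1, of "-1" 0] by simp
  have 3: "integrable lborel (\<lambda>t. sqrt \<bar>c\<bar> * (indicator {0..R} t * t powr (-1/2) + indicator {0..R} (- t) * (- t) powr (-1/2)))"
    using 1 2 by simp
  show ?thesis
  proof (rule Bochner_Integration.integrable_bound[OF 3])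
    show "AE t in lborel. norm (indicator (win m x) t * sqrt (c / \<bar>t\<bar>)) \<le>
      norm (sqrt \<bar>c\<bar> * (indicator {0..R} t * t powr (-1/2) + indicator {0..R} (- t) * (- t) powr (-1/2)))"
    proof (rule AE_I2)
      fix t :: real
      \<comment> \<open>At \<open>t = 0\<close> both sides are 0 by the conventions for division and
        \<open>powr\<close>; for negative \<open>c\<close> the root is negative, whence the absolute
        values.\<close>
      have h: "\<bar>sqrt (c / \<bar>t\<bar>)\<bar> = sqrt \<bar>c\<bar> * \<bar>t\<bar> powr (-1/2)"
      proof -
        have "\<bar>t\<bar> powr (-1/2) = 1 / sqrt \<bar>t\<bar>"
          using powr_minus_divide[of "\<bar>t\<bar>" "1/2"] by (simp add: powr_half_sqrt)
        moreover have "\<bar>sqrt c\<bar> = sqrt \<bar>c\<bar>"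
          by (cases "0 \<le> c") (auto simp: real_sqrt_minus[symmetric] simp del: real_sqrt_minus)
        ultimately show ?thesis by (simp add: real_sqrt_divide abs_divide)
      qed
      show "norm (indicator (win m x) t * sqrt (c / \<bar>t\<bar>)) \<le>
        norm (sqrt \<bar>c\<bar> * (indicator {0..R} t * t powr (-1/2) + indicator {0..R} (- t) * (- t) powr (-1/2)))"
      proof (cases "t \<in> win m x")
        case True
        then have "\<bar>t\<bar> \<le> R" by (auto simp: R_def)
        then show ?thesis using True h
          by (cases "0 < t"; cases "t = 0") (auto simp: indicator_def)
      qed auto
    qed
  qed auto
qed

text \<open>The common norm bound gives a common majorant on the window, so averaging turns almost
  everywhere convergence into convergence at every point.\<close>

lemma Aop_tendsto:
  assumes W: "\<And>n. unimodal (W n)" and L2: "\<And>n. W n \<in> L2R" and N: "\<And>n. L2norm_sq (W n) \<le> N"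
    and V: "unimodal V" and lim: "AE x in lborel. (\<lambda>n. W n x) \<longlonglongrightarrow> V x"
  shows "(\<lambda>n. Aop m (W n) x) \<longlonglongrightarrow> Aop m V x"
  unfolding Aop_eq
proof (rule integral_dominated_convergence)
  note [measurable] = unimodal_measurable[OF W] unimodal_measurable[OF V]
  show "(\<lambda>t. indicator (win m x) t * V t) \<in> borel_measurable lborel"
    and "(\<lambda>t. indicator (win m x) t * W n t) \<in> borel_measurable lborel" for n
    by measurable
  show "integrable lborel (\<lambda>t. indicator (win m x) t * sqrt ((N / 2) / \<bar>t\<bar>))"
    by (rule integrable_inverse_sqrt_win)
  show "AE t in lborel. (\<lambda>n. indicator (win m x) t * W n t) \<longlonglongrightarrow> indicator (win m x) t * V t"
    using lim by eventually_elim (intro tendsto_intros)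
  show "AE t in lborel. norm (indicator (win m x) t * W n t) \<le> indicator (win m x) t * sqrt ((N / 2) / \<bar>t\<bar>)" for n
    using AE_lborel_singleton[of 0]
  proof eventually_elim
    case (elim t)
    have "W n t \<le> sqrt (L2norm_sq (W n) / (2 * \<bar>t\<bar>))"
      using unimodal_bound[OF W L2] elim by auto
    also have "\<dots> \<le> sqrt ((N / 2) / \<bar>t\<bar>)"
      using N[of n] elim by (auto simp: divide_right_mono)
    finally show ?case using unimodal_nonneg[OF W, of n t] by (auto simp: indicator_def)
  qed
qed

text \<open>Fatou's lemma: mass may be lost in the limit but not created.\<close>

lemma L2_Fatou:
  assumes L2: "\<And>n. W n \<in> L2R" and N: "\<And>n. L2norm_sq (W n) \<le> N"
    and [measurable]: "V \<in> borel_measurable borel" and lim: "AE x in lborel. (\<lambda>n. W n x) \<longlonglongrightarrow> V x"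
  shows "V \<in> L2R" "L2norm_sq V \<le> N"
proof -
  note [measurable] = L2R_measurable[OF L2]
  have N0: "0 \<le> N" using N[of 0] L2norm_sq_nonneg[of "W 0"] by simp
  have "(\<integral>\<^sup>+x. ennreal ((V x)\<^sup>2) \<partial>lborel) = (\<integral>\<^sup>+x. liminf (\<lambda>n. ennreal ((W n x)\<^sup>2)) \<partial>lborel)"
  proof (rule nn_integral_cong_AE)
    show "AE x in lborel. ennreal ((V x)\<^sup>2) = liminf (\<lambda>n. ennreal ((W n x)\<^sup>2))"
      using lim
    proof eventually_elim
      case (elim x)
      then have "(\<lambda>n. ennreal ((W n x)\<^sup>2)) \<longlonglongrightarrow> ennreal ((V x)\<^sup>2)"
        by (intro tendsto_intros)
      then show ?case by (intro lim_imp_Liminf[symmetric]) simp_all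
    qed
  qed
  also have "\<dots> \<le> liminf (\<lambda>n. \<integral>\<^sup>+x. ennreal ((W n x)\<^sup>2) \<partial>lborel)"
    by (rule nn_integral_liminf) measurable
  also have "\<dots> \<le> ennreal N"
    using N by (intro Liminf_le always_eventually) (auto simp: L2norm_sq_nn[OF L2] ennreal_leI)
  finally show "V \<in> L2R" "L2norm_sq V \<le> N"
    using L2R_I_nn[OF _ _ N0] by auto
qed

text \<open>Fatou's lemma as an eventual strict bound, ready to be combined with other eventual
  estimates. Negative \<open>b\<close> is treated apart because \<open>ennreal\<close> truncates it
  to 0.\<close>

lemma Fatou_real_less:
  fixes f :: "nat \<Rightarrow> 'a \<Rightarrow> real"
  assumes int: "\<And>n. integrable M (f n)" "integrable M g" and nn: "\<And>n x. 0 \<le> f n x"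
    and lim: "AE x in M. (\<lambda>n. f n x) \<longlonglongrightarrow> g x" and b: "b < (\<integral>x. g x \<partial>M)"
  shows "\<forall>\<^sub>F n in sequentially. b < (\<integral>x. f n x \<partial>M)"
proof (cases "b < 0")
  case True
  then show ?thesis using nn by (intro always_eventually allI) (auto intro: less_le_trans)
next
  case False
  note [measurable] = int[THEN borel_measurable_integrable]
  have g: "AE x in M. 0 \<le> g x"
    using lim by eventually_elim (metis LIMSEQ_le_const nn)
  have "ennreal b < ennreal (\<integral>x. g x \<partial>M)" using b False by (simp add: ennreal_less_iff)
  also have "\<dots> = (\<integral>\<^sup>+x. ennreal (g x) \<partial>M)" using g int by (simp add: nn_integral_eq_integral)
  also have "\<dots> = (\<integral>\<^sup>+x. liminf (\<lambda>n. ennreal (f n x)) \<partial>M)"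
  proof (rule nn_integral_cong_AE)
    show "AE x in M. ennreal (g x) = liminf (\<lambda>n. ennreal (f n x))"
      using lim
    proof eventually_elim
      case (elim x)
      then have "(\<lambda>n. ennreal (f n x)) \<longlonglongrightarrow> ennreal (g x)"
        by (intro tendsto_intros)
      then show ?case by (intro lim_imp_Liminf[symmetric]) simp_all
    qed
  qed
  also have "\<dots> \<le> liminf (\<lambda>n. \<integral>\<^sup>+x. ennreal (f n x) \<partial>M)"
    by (rule nn_integral_liminf) measurable
  also have "\<dots> = liminf (\<lambda>n. ennreal (\<integral>x. f n x \<partial>M))"
    using int nn by (simp add: nn_integral_eq_integral)
  finally have "\<forall>\<^sub>F n in sequentially. ennreal b < ennreal (\<integral>x. f n x \<partial>M)"
    by (rule less_LiminfD)
  then show ?thesis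
    using False by (simp add: ennreal_less_iff)
qed

section \<open>Convex potentials\<close>

text \<open>\<open>g\<close> and \<open>h\<close> are the first two derivatives of \<open>G\<close>;
  monotonicity of \<open>h\<close> stands for a nonnegative third derivative. Continuity of
  \<open>h\<close> at 0 makes \<open>G\<close> nearly quadratic at small amplitudes.\<close>

locale convex_potential =
  fixes G g h :: "real \<Rightarrow> real" and b :: real
  assumes b_nonneg: "0 \<le> b"
    and G_0: "G 0 = 0" and g_0: "g 0 = 0"
    and DERIV_G: "\<And>u. 0 \<le> u \<Longrightarrow> u \<le> b \<Longrightarrow> (G has_real_derivative g u) (at u)"
    and DERIV_g: "\<And>u. 0 \<le> u \<Longrightarrow> u \<le> b \<Longrightarrow> (g has_real_derivative h u) (at u)"
    and h_mono: "\<And>u v. 0 \<le> u \<Longrightarrow> u \<le> v \<Longrightarrow> v \<le> b \<Longrightarrow> h u \<le> h v"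
    and h_0: "0 \<le> h 0" and isCont_h_0: "isCont h 0"
begin

lemma h_nonneg: "0 \<le> u \<Longrightarrow> u \<le> b \<Longrightarrow> 0 \<le> h u"
  using h_mono[of 0 u] h_0 by simp

lemma g_mono: "0 \<le> u \<Longrightarrow> u \<le> v \<Longrightarrow> v \<le> b \<Longrightarrow> g u \<le> g v"
  by (rule DERIV_nonneg_imp_nondecreasing, assumption)
    (meson DERIV_g h_nonneg order_trans)

lemma g_nonneg: "0 \<le> u \<Longrightarrow> u \<le> b \<Longrightarrow> 0 \<le> g u"
  using g_mono[of 0 u] g_0 by simp

lemma G_mono: "0 \<le> u \<Longrightarrow> u \<le> v \<Longrightarrow> v \<le> b \<Longrightarrow> G u \<le> G v"
  by (rule DERIV_nonneg_imp_nondecreasing, assumption)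
    (meson DERIV_G g_nonneg order_trans)

lemma G_nonneg: "0 \<le> u \<Longrightarrow> u \<le> b \<Longrightarrow> 0 \<le> G u"
  using G_mono[of 0 u] G_0 by simp

text \<open>Here and in the next three bounds, monotonicity of \<open>h\<close> is integrated once
  or twice from 0, by showing that the difference of the two sides has a nonnegative
  derivative.\<close>

lemma g_le:
  assumes "0 \<le> u" "u \<le> v" "v \<le> b"
  shows "g u \<le> h v * u"
proof -
  have "h v * 0 - g 0 \<le> h v * u - g u"
  proof (rule DERIV_nonneg_imp_nondecreasing[of 0 u "\<lambda>u. h v * u - g u"])
    fix x assume x: "0 \<le> x" "x \<le> u"
    then have "((\<lambda>u. h v * u - g u) has_real_derivative (h v - h x)) (at x)"
      using assms by (auto intro!: derivative_eq_intros DERIV_g)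
    moreover have "h x \<le> h v" using x assms by (intro h_mono) auto
    ultimately show "\<exists>y. ((\<lambda>u. h v * u - g u) has_real_derivative y) (at x) \<and> 0 \<le> y"
      by (intro exI[of _ "h v - h x"]) simp
  qed (use assms in auto)
  then show ?thesis by (simp add: g_0)
qed

lemma g_ge:
  assumes "0 \<le> u" "u \<le> b"
  shows "h 0 * u \<le> g u"
proof -
  have "g 0 - h 0 * 0 \<le> g u - h 0 * u"
  proof (rule DERIV_nonneg_imp_nondecreasing[of 0 u "\<lambda>u. g u - h 0 * u"])
    fix x assume x: "0 \<le> x" "x \<le> u"
    then have "((\<lambda>u. g u - h 0 * u) has_real_derivative (h x - h 0)) (at x)"
      using assms by (auto intro!: derivative_eq_intros DERIV_g)
    moreover have "h 0 \<le> h x" using x assms by (intro h_mono) auto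
    ultimately show "\<exists>y. ((\<lambda>u. g u - h 0 * u) has_real_derivative y) (at x) \<and> 0 \<le> y"
      by (intro exI[of _ "h x - h 0"]) simp
  qed (use assms in auto)
  then show ?thesis by (simp add: g_0)
qed

lemma G_le:
  assumes "0 \<le> u" "u \<le> v" "v \<le> b"
  shows "G u \<le> h v / 2 * u\<^sup>2"
proof -
  have "h v / 2 * 0\<^sup>2 - G 0 \<le> h v / 2 * u\<^sup>2 - G u"
  proof (rule DERIV_nonneg_imp_nondecreasing[of 0 u "\<lambda>u. h v / 2 * u\<^sup>2 - G u"])
    fix x assume x: "0 \<le> x" "x \<le> u"
    then have "((\<lambda>u. h v / 2 * u\<^sup>2 - G u) has_real_derivative (h v * x - g x)) (at x)"
      using assms by (auto intro!: derivative_eq_intros DERIV_G)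
    moreover have "g x \<le> h v * x" using x assms by (intro g_le) auto
    ultimately show "\<exists>y. ((\<lambda>u. h v / 2 * u\<^sup>2 - G u) has_real_derivative y) (at x) \<and> 0 \<le> y"
      by (intro exI[of _ "h v * x - g x"]) simp
  qed (use assms in auto)
  then show ?thesis by (simp add: G_0)
qed

lemma G_ge:
  assumes "0 \<le> u" "u \<le> b"
  shows "h 0 / 2 * u\<^sup>2 \<le> G u"
proof -
  have "G 0 - h 0 / 2 * 0\<^sup>2 \<le> G u - h 0 / 2 * u\<^sup>2"
  proof (rule DERIV_nonneg_imp_nondecreasing[of 0 u "\<lambda>u. G u - h 0 / 2 * u\<^sup>2"])
    fix x assume x: "0 \<le> x" "x \<le> u"
    then have "((\<lambda>u. G u - h 0 / 2 * u\<^sup>2) has_real_derivative (g x - h 0 * x)) (at x)"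
      using assms by (auto intro!: derivative_eq_intros DERIV_G)
    moreover have "h 0 * x \<le> g x" using x assms by (intro g_ge) auto
    ultimately show "\<exists>y. ((\<lambda>u. G u - h 0 / 2 * u\<^sup>2) has_real_derivative y) (at x) \<and> 0 \<le> y"
      by (intro exI[of _ "g x - h 0 * x"]) simp
  qed (use assms in auto)
  then show ?thesis by (simp add: G_0)
qed

text \<open>As \<open>g\<close> increases, \<open>G\<close> minus its tangent slope times the
  variable increases to the right of \<open>u\<close> and decreases to its left; hence the two
  cases.\<close>

lemma G_convex:
  assumes u: "0 \<le> u" "u \<le> b" and v: "0 \<le> v" "v \<le> b"
  shows "G u + g u * (v - u) \<le> G v"
proof (cases "u \<le> v")
  case True
  have "G u - g u * u \<le> G v - g u * v"
  proof (rule DERIV_nonneg_imp_nondecreasing[of u v "\<lambda>x. G x - g u * x"])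
    fix x assume x: "u \<le> x" "x \<le> v"
    then have "((\<lambda>x. G x - g u * x) has_real_derivative (g x - g u)) (at x)"
      using u v by (auto intro!: derivative_eq_intros DERIV_G)
    moreover have "g u \<le> g x" using x u v by (intro g_mono) auto
    ultimately show "\<exists>y. ((\<lambda>x. G x - g u * x) has_real_derivative y) (at x) \<and> 0 \<le> y"
      by (intro exI[of _ "g x - g u"]) simp
  qed (use True in auto)
  then show ?thesis by (simp add: algebra_simps)
next
  case False
  have "g u * v - G v \<le> g u * u - G u"
  proof (rule DERIV_nonneg_imp_nondecreasing[of v u "\<lambda>x. g u * x - G x"])
    fix x assume x: "v \<le> x" "x \<le> u"
    then have "((\<lambda>x. g u * x - G x) has_real_derivative (g u - g x)) (at x)"
      using u v by (auto intro!: derivative_eq_intros DERIV_G)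
    moreover have "g x \<le> g u" using x u v by (intro g_mono) auto
    ultimately show "\<exists>y. ((\<lambda>x. g u * x - G x) has_real_derivative y) (at x) \<and> 0 \<le> y"
      by (intro exI[of _ "g u - g x"]) simp
  qed (use False in auto)
  then show ?thesis by (simp add: algebra_simps)
qed

lemma G_le_mult_g: "0 \<le> u \<Longrightarrow> u \<le> b \<Longrightarrow> G u \<le> g u * u"
  using G_convex[of u 0] b_nonneg by (simp add: G_0)

text \<open>Growth at least quadratic: \<open>h y \<le> h (s * y)\<close> integrates to
  \<open>s * g x \<le> g (s * x)\<close>, and this integrates to the claim.\<close>

lemma G_scale:
  assumes s: "1 \<le> s" and u: "0 \<le> u" "s * u \<le> b"
  shows "s\<^sup>2 * G u \<le> G (s * u)"
proof -
  have le: "x \<le> s * x" if "0 \<le> x" for x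
    using s that by (simp add: mult_le_cancel_right1)
  have sb: "s * x \<le> b" if "x \<le> u" for x
    using s that u by (meson dual_order.trans mult_left_mono zero_le_one)
  have g: "s * g x \<le> g (s * x)" if x: "0 \<le> x" "x \<le> u" for x
  proof -
    have "g (s * 0) - s * g 0 \<le> g (s * x) - s * g x"
    proof (rule DERIV_nonneg_imp_nondecreasing[of 0 x "\<lambda>x. g (s * x) - s * g x"])
      fix y assume y: "0 \<le> y" "y \<le> x"
      then have "0 \<le> s * y" "s * y \<le> b" "y \<le> s * y" "y \<le> b"
        using s le[of y] sb[of y] x by auto
      then have "((\<lambda>x. g (s * x) - s * g x) has_real_derivative (h (s * y) * s - s * h y)) (at y)"
        using y by (auto intro!: derivative_eq_intros DERIV_chain2[where f = g and g = "\<lambda>x. s * x"] DERIV_g)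
      moreover have "0 \<le> h (s * y) * s - s * h y"
        using h_mono[of y "s * y"] y \<open>s * y \<le> b\<close> \<open>y \<le> s * y\<close> s by (simp add: mult.commute mult_left_mono)
      ultimately show "\<exists>z. ((\<lambda>x. g (s * x) - s * g x) has_real_derivative z) (at y) \<and> 0 \<le> z"
        by blast
    qed (use x in auto)
    then show ?thesis by (simp add: g_0)
  qed
  have "G (s * 0) - s\<^sup>2 * G 0 \<le> G (s * u) - s\<^sup>2 * G u"
  proof (rule DERIV_nonneg_imp_nondecreasing[of 0 u "\<lambda>x. G (s * x) - s\<^sup>2 * G x"])
    fix y assume y: "0 \<le> y" "y \<le> u"
    then have "0 \<le> s * y" "s * y \<le> b" "y \<le> b"
      using s le[of y] sb[of y] by auto
    then have "((\<lambda>x. G (s * x) - s\<^sup>2 * G x) has_real_derivative (g (s * y) * s - s\<^sup>2 * g y)) (at y)"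
      using y by (auto intro!: derivative_eq_intros DERIV_chain2[where f = G and g = "\<lambda>x. s * x"] DERIV_G)
    moreover have "0 \<le> g (s * y) * s - s\<^sup>2 * g y"
      using mult_left_mono[OF g[OF y], of s] s by (simp add: power2_eq_square mult.commute mult.assoc)
    ultimately show "\<exists>z. ((\<lambda>x. G (s * x) - s\<^sup>2 * G x) has_real_derivative z) (at y) \<and> 0 \<le> z"
      by blast
  qed (use u in auto)
  then show ?thesis by (simp add: G_0)
qed

end

text \<open>Taylor's formula: the lower bound on the third derivative is integrated three times,
  which produces the factor 1/6.\<close>

lemma cubic_lower_bound:
  fixes G g h :: "real \<Rightarrow> real"
  assumes "convex_potential G g h b"
    and dh: "\<And>u. 0 \<le> u \<Longrightarrow> u \<le> b \<Longrightarrow> (h has_real_derivative k u) (at u)"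
    and k: "\<And>u. 0 \<le> u \<Longrightarrow> u \<le> b \<Longrightarrow> \<kappa> \<le> k u"
    and u: "0 \<le> u" "u \<le> b"
  shows "h 0 / 2 * u\<^sup>2 + \<kappa> / 6 * u ^ 3 \<le> G u"
proof -
  interpret convex_potential G g h b by fact
  have 1: "\<kappa> * x \<le> h x - h 0" if "0 \<le> x" "x \<le> u" for x
  proof -
    have "h 0 - \<kappa> * 0 \<le> h x - \<kappa> * x"
    proof (rule DERIV_nonneg_imp_nondecreasing[of 0 x "\<lambda>x. h x - \<kappa> * x"])
      fix y assume "0 \<le> y" "y \<le> x"
      then show "\<exists>z. ((\<lambda>x. h x - \<kappa> * x) has_real_derivative z) (at y) \<and> 0 \<le> z"
        using that u k[of y] by (intro exI[of _ "k y - \<kappa>"]) (auto intro!: derivative_eq_intros dh)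
    qed (use that in auto)
    then show ?thesis by simp
  qed
  have 2: "h 0 * x + \<kappa> / 2 * x\<^sup>2 \<le> g x" if "0 \<le> x" "x \<le> u" for x
  proof -
    have "g 0 - (h 0 * 0 + \<kappa> / 2 * 0\<^sup>2) \<le> g x - (h 0 * x + \<kappa> / 2 * x\<^sup>2)"
    proof (rule DERIV_nonneg_imp_nondecreasing[of 0 x "\<lambda>x. g x - (h 0 * x + \<kappa> / 2 * x\<^sup>2)"])
      fix y assume "0 \<le> y" "y \<le> x"
      then show "\<exists>z. ((\<lambda>x. g x - (h 0 * x + \<kappa> / 2 * x\<^sup>2)) has_real_derivative z) (at y) \<and> 0 \<le> z"
        using that u 1[of y] by (intro exI[of _ "h y - (h 0 + \<kappa> * y)"]) (auto intro!: derivative_eq_intros DERIV_g)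
    qed (use that in auto)
    then show ?thesis by (simp add: g_0)
  qed
  have "G 0 - (h 0 / 2 * 0\<^sup>2 + \<kappa> / 6 * 0 ^ 3) \<le> G u - (h 0 / 2 * u\<^sup>2 + \<kappa> / 6 * u ^ 3)"
  proof (rule DERIV_nonneg_imp_nondecreasing[of 0 u "\<lambda>x. G x - (h 0 / 2 * x\<^sup>2 + \<kappa> / 6 * x ^ 3)"])
    fix y assume "0 \<le> y" "y \<le> u"
    then show "\<exists>z. ((\<lambda>x. G x - (h 0 / 2 * x\<^sup>2 + \<kappa> / 6 * x ^ 3)) has_real_derivative z) (at y) \<and> 0 \<le> z"
      using u 2[of y] by (intro exI[of _ "g y - (h 0 * y + \<kappa> / 2 * y\<^sup>2)"]) (auto intro!: derivative_eq_intros DERIV_G simp: power2_eq_square)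
  qed (use u in auto)
  then show ?thesis by (simp add: G_0)
qed

lemma L2norm_sq_cmult: "L2norm_sq (\<lambda>x. c * W x) = c\<^sup>2 * L2norm_sq W"
  by (simp add: L2norm_sq_def power_mult_distrib)

lemma L2R_cmult: "W \<in> L2R \<Longrightarrow> (\<lambda>x. c * W x) \<in> L2R"
  by (auto simp: L2R_def power_mult_distrib)

lemma unimodal_cmult: "unimodal W \<Longrightarrow> 0 \<le> c \<Longrightarrow> unimodal (\<lambda>x. c * W x)"
  by (auto simp: unimodal_def mult_left_mono)

lemma integrable_mult_indicator_real:
  fixes f :: "'a \<Rightarrow> real"
  assumes "A \<in> sets M" "integrable M f"
  shows "integrable M (\<lambda>x. indicator A x * f x)"
  using integrable_mult_indicator[OF assms] by simp

lemma integral_split_indicator: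
  fixes f :: "'a \<Rightarrow> real"
  assumes "A \<in> sets M" "integrable M f"
  shows "(\<integral>x. f x \<partial>M) = (\<integral>x. indicator A x * f x \<partial>M) + (\<integral>x. indicator (- A) x * f x \<partial>M)"
proof -
  have "(\<integral>x. indicator (- A) x * f x \<partial>M) = (\<integral>x. f x - indicator A x * f x \<partial>M)"
    by (intro Bochner_Integration.integral_cong) (auto simp: indicator_def)
  then show ?thesis
    using integrable_mult_indicator_real[OF assms] assms(2) by simp
qed

section \<open>The variational functional on the admissible set\<close>

declare of_nat_Suc [simp del]

text \<open>Index \<open>n\<close> stands for the interaction range \<open>m = Suc n\<close>. The
  assumption \<open>cubic\<close> is the strict anharmonicity of the nearest-neighbour potential,
  and \<open>summable_h0\<close> limits the long-range forces; the two compete in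
  \<open>threshold\<close>.\<close>

locale potential_family =
  fixes K \<gamma> \<kappa> :: real and G g h :: "nat \<Rightarrow> real \<Rightarrow> real"
  assumes K_pos: "0 < K" and \<gamma>: "5/2 < \<gamma>" "\<gamma> < 3"
    and potential: "\<And>n. convex_potential (G n) (g n) (h n) (sqrt (2 * K * real (Suc n)))"
    and \<kappa>_pos: "0 < \<kappa>"
    and cubic: "\<And>u. 0 \<le> u \<Longrightarrow> u \<le> sqrt (2 * K) \<Longrightarrow> h 0 0 / 2 * u\<^sup>2 + \<kappa> * u ^ 3 \<le> G 0 u"
    and summable_h: "summable (\<lambda>n. h n (sqrt (2 * K * real (Suc n))) * (real (Suc n))\<^sup>2)"
    and summable_h0: "summable (\<lambda>n. h n 0 * real (Suc n) powr \<gamma>)"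
begin

abbreviation A :: "nat \<Rightarrow> (real \<Rightarrow> real) \<Rightarrow> real \<Rightarrow> real" where "A n \<equiv> Aop (Suc n)"

abbreviation b :: "nat \<Rightarrow> real" where "b n \<equiv> sqrt (2 * K * real (Suc n))"

text \<open>Up to constant factors this is the summable majorant for the series over
  \<open>n\<close>.\<close>

abbreviation E :: "nat \<Rightarrow> real" where "E n \<equiv> h n (b n) * (real (Suc n))\<^sup>2"

text \<open>The norm is bounded rather than prescribed, so that limits which lose mass stay in
  \<open>S\<close>.\<close>

definition S :: "(real \<Rightarrow> real) set" where
  "S = {W. unimodal W \<and> W \<in> L2R \<and> L2norm_sq W \<le> 2 * K}"

definition p :: "nat \<Rightarrow> (real \<Rightarrow> real) \<Rightarrow> real" where
  "p n W = (\<integral>x. G n (A n W x) \<partial>lborel)"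

definition P :: "(real \<Rightarrow> real) \<Rightarrow> real" where
  "P W = (\<Sum>n. p n W)"

lemma b_pos: "0 < b n"
  using K_pos by simp

lemma h_b_nonneg: "0 \<le> h n (b n)"
  using convex_potential.h_nonneg[OF potential, of "b n" n] b_pos[of n] by simp

lemma h_0_le: "h n 0 \<le> h n (b n)"
  using convex_potential.h_mono[OF potential, of 0 "b n" n] b_pos[of n] by simp

lemma E_nonneg: "0 \<le> E n"
  using h_b_nonneg[of n] by simp

lemma summable_h0_sq: "summable (\<lambda>n. h n 0 * (real (Suc n))\<^sup>2)"
  using convex_potential.h_0[OF potential] h_0_le
  by (intro summable_comparison_test[OF _ summable_h]) (auto intro!: exI[of _ 0] mult_right_mono simp: abs_mult)

lemma S_D: "W \<in> S \<Longrightarrow> unimodal W" "W \<in> S \<Longrightarrow> W \<in> L2R" "W \<in> S \<Longrightarrow> L2norm_sq W \<le> 2 * K"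
  by (auto simp: S_def)

lemma A_unimodal: "W \<in> S \<Longrightarrow> unimodal (A n W)"
  by (intro unimodal_Aop S_D L2R_win_integrable)

lemma A_nonneg: "W \<in> S \<Longrightarrow> 0 \<le> A n W x"
  using A_unimodal by (rule unimodal_nonneg)

text \<open>This keeps the averages inside the interval on which the potentials are
  controlled.\<close>

lemma A_le_b: assumes "W \<in> S" shows "A n W x \<le> b n"
proof -
  have "A n W x \<le> sqrt (real (Suc n) * L2norm_sq W)"
    using Aop_abs_le[OF S_D(2)[OF assms], of "Suc n" x] by linarith
  also have "\<dots> \<le> b n"
    using mult_left_mono[OF S_D(3)[OF assms], of "real (Suc n)"] by (simp add: mult.commute mult.left_commute)
  finally show ?thesis .
qed

lemma A_L2: assumes "W \<in> S" shows "A n W \<in> L2R" "L2norm_sq (A n W) \<le> (real (Suc n))\<^sup>2 * (2 * K)"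
proof -
  show "A n W \<in> L2R" using Aop_L2(1)[OF S_D(2)[OF assms]] .
  show "L2norm_sq (A n W) \<le> (real (Suc n))\<^sup>2 * (2 * K)"
    using Aop_L2(2)[OF S_D(2)[OF assms], of "Suc n"] mult_left_mono[OF S_D(3)[OF assms], of "(real (Suc n))\<^sup>2"]
    by (meson order_trans zero_le_power2)
qed

lemma unimodal_comp_A:
  assumes W: "W \<in> S" and f: "\<And>u v. 0 \<le> u \<Longrightarrow> u \<le> v \<Longrightarrow> v \<le> b n \<Longrightarrow> f u \<le> f v"
    "\<And>u. 0 \<le> u \<Longrightarrow> u \<le> b n \<Longrightarrow> 0 \<le> f u"
  shows "unimodal (\<lambda>x. f (A n W x))"
  using unimodal_minus[OF A_unimodal[OF W]] unimodal_antimono[OF A_unimodal[OF W]]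
  by (intro unimodalI f) (auto simp: A_nonneg[OF W] A_le_b[OF W])

lemma unimodal_G_A: "W \<in> S \<Longrightarrow> unimodal (\<lambda>x. G n (A n W x))"
  and unimodal_g_A: "W \<in> S \<Longrightarrow> unimodal (\<lambda>x. g n (A n W x))"
  by (rule unimodal_comp_A, assumption, erule (2) convex_potential.G_mono[OF potential],
      erule (1) convex_potential.G_nonneg[OF potential])
    (rule unimodal_comp_A, assumption, erule (2) convex_potential.g_mono[OF potential],
      erule (1) convex_potential.g_nonneg[OF potential])

lemma integrable_G_A:
  assumes W: "W \<in> S"
  shows "integrable lborel (\<lambda>x. G n (A n W x))"
proof (rule Bochner_Integration.integrable_bound)
  show "integrable lborel (\<lambda>x. h n (b n) / 2 * (A n W x)\<^sup>2)"
    by (intro integrable_mult_right L2R_integrable A_L2 W)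
  show "(\<lambda>x. G n (A n W x)) \<in> borel_measurable lborel"
    using unimodal_measurable[OF unimodal_G_A[OF W]] by simp
  show "AE x in lborel. norm (G n (A n W x)) \<le> norm (h n (b n) / 2 * (A n W x)\<^sup>2)"
    using convex_potential.G_le[OF potential A_nonneg[OF W] A_le_b[OF W] order_refl] unimodal_nonneg[OF unimodal_G_A[OF W]] h_b_nonneg
    by (intro AE_I2) (auto simp: abs_mult)
qed

lemma p_nonneg: "W \<in> S \<Longrightarrow> 0 \<le> p n W"
  unfolding p_def using unimodal_nonneg[OF unimodal_G_A] by simp

text \<open>Integrate the quadratic bound on \<open>G n\<close>. Retaining the norm of
  \<open>W\<close>, not only its bound \<open>2 * K\<close>, later excludes a limit of norm
  0.\<close>

lemma p_le_norm:
  assumes W: "W \<in> S"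
  shows "p n W \<le> E n / 2 * L2norm_sq W"
proof -
  have "p n W \<le> (\<integral>x. h n (b n) / 2 * (A n W x)\<^sup>2 \<partial>lborel)"
    unfolding p_def
  proof (rule integral_mono)
    show "integrable lborel (\<lambda>x. h n (b n) / 2 * (A n W x)\<^sup>2)"
      by (intro integrable_mult_right L2R_integrable A_L2 W)
  qed (rule integrable_G_A[OF W], rule convex_potential.G_le[OF potential A_nonneg[OF W] A_le_b[OF W] order_refl])
  also have "\<dots> = h n (b n) / 2 * L2norm_sq (A n W)"
    by (simp add: L2norm_sq_def)
  also have "\<dots> \<le> h n (b n) / 2 * ((real (Suc n))\<^sup>2 * L2norm_sq W)"
    using h_b_nonneg by (intro mult_left_mono Aop_L2 S_D W) auto
  finally show ?thesis by (simp add: mult_ac)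
qed

lemma p_le:
  assumes W: "W \<in> S"
  shows "p n W \<le> E n * K"
  using p_le_norm[OF W, of n] mult_left_mono[OF S_D(3)[OF W], of "E n / 2"] E_nonneg[of n] by simp

lemma summable_p: "W \<in> S \<Longrightarrow> summable (\<lambda>n. p n W)"
  using p_nonneg p_le
  by (intro summable_comparison_test[OF _ summable_mult2[OF summable_h, of K]]) (auto intro!: exI[of _ 0])

lemma P_le: "W \<in> S \<Longrightarrow> P W \<le> (\<Sum>n. E n * K)"
  unfolding P_def by (intro suminf_le p_le summable_p summable_mult2 summable_h)

end

section \<open>Existence of a maximiser\<close>

lemma integrable_indicator_Icc: "integrable lborel (indicator {a..b} :: real \<Rightarrow> real)"
  by (rule integrable_real_indicator) (auto simp: emeasure_lborel_Icc_eq)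

context potential_family
begin

text \<open>Since averaging over length \<open>m\<close> has operator norm at most \<open>m\<close>,
  the quadratic part of \<open>P W\<close> is at most \<open>c0 / 2 * L2norm_sq W\<close>.\<close>

definition c0 :: real where
  "c0 = (\<Sum>n. h n 0 * (real (Suc n))\<^sup>2)"

lemma box_in_S:
  assumes L: "0 < L"
  defines "W \<equiv> \<lambda>x. sqrt (K / L) * indicator {-L..L} x"
  shows "W \<in> S" "L2norm_sq W = 2 * K"
proof -
  have sq: "(W x)\<^sup>2 = K / L * indicator {-L..L} x" for x
    using K_pos L by (simp add: W_def power_mult_distrib indicator_def)
  have u: "unimodal W"
    by (rule unimodalI) (use K_pos L in \<open>auto simp: W_def indicator_def\<close>)
  have "integrable lborel (\<lambda>x. (W x)\<^sup>2)"
    unfolding sq by (intro integrable_mult_right integrable_indicator_Icc)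
  then have "W \<in> L2R"
    using unimodal_measurable[OF u] by (simp add: L2R_def)
  moreover show "L2norm_sq W = 2 * K"
    using L by (simp add: L2norm_sq_def sq)
  ultimately show "W \<in> S" using u by (simp add: S_def)
qed

text \<open>A window centred within distance \<open>L - m / 2\<close> of 0 lies in the box, so the
  average is constant there, on a plateau of length \<open>2 * L - m\<close>; outside,
  \<open>G n\<close> is nonnegative. The second claim is the bound \<open>A_le_b\<close> at the
  centre.\<close>

lemma p_box_ge:
  assumes L: "0 < L" and n: "real (Suc n) \<le> 2 * L"
  shows "(2 * L - real (Suc n)) * G n (sqrt (K / L) * real (Suc n)) \<le> p n (\<lambda>x. sqrt (K / L) * indicator {-L..L} x)"
    and "sqrt (K / L) * real (Suc n) \<le> b n"
proof -
  define W where "W = (\<lambda>x. sqrt (K / L) * indicator {-L..L} x)"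
  define r where "r = L - real (Suc n) / 2"
  have r: "0 \<le> r" using n by (simp add: r_def)
  have W: "W \<in> S" using box_in_S[OF L] by (simp add: W_def)
  have A: "A n W x = sqrt (K / L) * real (Suc n)" if "\<bar>x\<bar> \<le> r" for x
  proof -
    have "A n W x = A n (\<lambda>_. sqrt (K / L)) x"
      unfolding Aop_eq using that
      by (intro Bochner_Integration.integral_cong) (auto simp: W_def r_def indicator_def)
    then show ?thesis by (simp add: Aop_const mult.commute)
  qed
  show "sqrt (K / L) * real (Suc n) \<le> b n"
    using A_le_b[OF W, of n 0] A[of 0] r by simp
  have "(2 * L - real (Suc n)) * G n (sqrt (K / L) * real (Suc n)) = (\<integral>x. indicator {-r..r} x * G n (sqrt (K / L) * real (Suc n)) \<partial>lborel)"
    using r by (simp add: r_def)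
  also have "\<dots> \<le> p n W"
    unfolding p_def
  proof (rule integral_mono)
    fix x show "indicator {-r..r} x * G n (sqrt (K / L) * real (Suc n)) \<le> G n (A n W x)"
      using A[of x] unimodal_nonneg[OF unimodal_G_A[OF W]] by (auto simp: indicator_def)
    show "integrable lborel (\<lambda>x. indicator {-r..r} x * G n (sqrt (K / L) * real (Suc n)))"
      by (intro integrable_mult_left integrable_indicator_Icc)
  qed (rule integrable_G_A[OF W])
  finally show "(2 * L - real (Suc n)) * G n (sqrt (K / L) * real (Suc n)) \<le> p n (\<lambda>x. sqrt (K / L) * indicator {-L..L} x)"
    by (simp add: W_def)
qed

lemma threshold: "\<exists>W\<in>S. L2norm_sq W = 2 * K \<and> c0 * K < P W"
proof -
  define \<alpha> where "\<alpha> = \<gamma> - 2"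
  have \<alpha>: "1/2 < \<alpha>" "\<alpha> < 1" using \<gamma> by (auto simp: \<alpha>_def)
  define \<Gamma> where "\<Gamma> = (\<Sum>n. h n 0 * real (Suc n) powr \<gamma>)"
  have h0: "0 \<le> h n 0" for n using convex_potential.h_0[OF potential] .
  have \<Gamma>: "0 \<le> \<Gamma>" unfolding \<Gamma>_def by (intro suminf_nonneg summable_h0) (simp add: h0)
  \<comment> \<open>Loss divided by gain behaves like \<open>L powr (1/2 - \<alpha>)\<close>; the
    exponent is negative precisely because \<open>\<gamma> > 5/2\<close>, so a long box
    wins.\<close>
  have "((\<lambda>L. \<Gamma> * L powr (1/2 - \<alpha>)) \<longlongrightarrow> \<Gamma> * 0) at_top"
    using \<alpha> by (intro tendsto_mult tendsto_const tendsto_neg_powr filterlim_ident) auto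
  moreover have "0 < \<kappa> * sqrt K" using \<kappa>_pos K_pos by simp
  ultimately have "\<forall>\<^sub>F L in at_top. \<Gamma> * L powr (1/2 - \<alpha>) < \<kappa> * sqrt K"
    by (simp add: order_tendstoD)
  then have "\<forall>\<^sub>F L in at_top. \<Gamma> * L powr (1/2 - \<alpha>) < \<kappa> * sqrt K \<and> 1 \<le> L"
    using eventually_ge_at_top[of 1] by eventually_elim simp
  then obtain L :: real where L: "\<Gamma> * L powr (1/2 - \<alpha>) < \<kappa> * sqrt K" "1 \<le> L"
    using eventually_happens'[OF trivial_limit_at_top_linorder] by blast
  have L0: "0 < L" using L by simp
  define W where "W = (\<lambda>x. sqrt (K / L) * indicator {-L..L} x)"
  have W: "W \<in> S" "L2norm_sq W = 2 * K" using box_in_S[OF L0] by (auto simp: W_def)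
  \<comment> \<open>The plateau of the box yields the factor \<open>1 - m / (2 * L)\<close>.
    Replacing \<open>m / (2 * L)\<close> by its power \<open>\<alpha> < 1\<close> only lowers it
    when \<open>m \<le> 2 * L\<close>, makes it nonpositive when \<open>m > 2 * L\<close>, and
    leaves a deficit summable by the moment of order \<open>\<gamma>\<close>.\<close>
  define q where "q n = h n 0 * (real (Suc n))\<^sup>2 * K - K * (2 * L) powr (- \<alpha>) * (h n 0 * real (Suc n) powr \<gamma>)" for n
  have powr: "(real (Suc n))\<^sup>2 * (real (Suc n) / (2 * L)) powr \<alpha> = (2 * L) powr (- \<alpha>) * real (Suc n) powr \<gamma>" for n
  proof -
    have "real (Suc n) powr \<gamma> = (real (Suc n))\<^sup>2 * real (Suc n) powr \<alpha>"
      using powr_add[of "real (Suc n)" 2 \<alpha>] by (simp add: \<alpha>_def powr_numeral)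
    moreover have "(real (Suc n) / (2 * L)) powr \<alpha> = real (Suc n) powr \<alpha> / (2 * L) powr \<alpha>"
      by (rule powr_divide)
    ultimately show ?thesis
      unfolding powr_minus_divide[of "2 * L" \<alpha>] by (simp only: times_divide_eq_right times_divide_eq_left mult_1)
  qed
  then have q: "q n = h n 0 * (real (Suc n))\<^sup>2 * K * (1 - (real (Suc n) / (2 * L)) powr \<alpha>)" for n
    unfolding q_def by (simp add: algebra_simps)
  have sq: "(sqrt (K / L))\<^sup>2 = K / L" using K_pos L0 by simp
  have le: "real (Suc n) / (2 * L) \<le> (real (Suc n) / (2 * L)) powr \<alpha>" if "real (Suc n) \<le> 2 * L" for n
    using powr_mono'[of \<alpha> 1 "real (Suc n) / (2 * L)"] \<alpha> that L0 by simp
  have qp: "q n + (if n = 0 then K * \<kappa> * sqrt (K / L) else 0) \<le> p n W" for n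
  proof (cases "real (Suc n) \<le> 2 * L")
    case True
    let ?v = "sqrt (K / L) * real (Suc n)"
    note pb = p_box_ge[OF L0 True, folded W_def]
    have v0: "0 \<le> ?v" using K_pos L0 by simp
    have "q n \<le> h n 0 * (real (Suc n))\<^sup>2 * K * (1 - real (Suc n) / (2 * L))"
      unfolding q using le[OF True] h0[of n] K_pos by (intro mult_left_mono) auto
    also have "\<dots> = (2 * L - real (Suc n)) * (h n 0 / 2 * ?v\<^sup>2)"
      using L0 by (simp add: power_mult_distrib sq field_simps)
    finally have 1: "q n \<le> (2 * L - real (Suc n)) * (h n 0 / 2 * ?v\<^sup>2)" .
    show ?thesis
    proof (cases "n = 0")
      \<comment> \<open>For \<open>m = 1\<close> the plateau has length
        \<open>2 * L - 1 \<ge> L\<close>, since \<open>L \<ge> 1\<close>, and the cubic term gains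
        at least \<open>L * \<kappa> * (sqrt (K / L)) ^ 3\<close>.\<close>
      case n: True
      have v: "?v = sqrt (K / L)" using n by (simp add: of_nat_Suc)
      have Ls: "L * (sqrt (K / L))\<^sup>2 = K" using sq L0 by simp
      have "L * (sqrt (K / L))\<^sup>2 * \<kappa> * sqrt (K / L) = L * (\<kappa> * sqrt (K / L) ^ 3)"
        by (simp only: power2_eq_square power3_eq_cube mult_ac)
      then have "K * \<kappa> * sqrt (K / L) = L * (\<kappa> * ?v ^ 3)"
        unfolding Ls v .
      also have "\<dots> \<le> (2 * L - real (Suc n)) * (\<kappa> * ?v ^ 3)"
        using n L \<kappa>_pos v0 by (intro mult_right_mono) (auto simp: of_nat_Suc)
      finally have "q n + K * \<kappa> * sqrt (K / L) \<le> (2 * L - real (Suc n)) * (h n 0 / 2 * ?v\<^sup>2 + \<kappa> * ?v ^ 3)"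
        using 1 by (simp add: distrib_left)
      also have "\<dots> \<le> (2 * L - real (Suc n)) * G n ?v"
        using True cubic[OF v0] pb(2) n by (intro mult_left_mono) (auto simp: of_nat_Suc)
      finally show ?thesis using pb(1) n by simp
    next
      case False
      have "(2 * L - real (Suc n)) * (h n 0 / 2 * ?v\<^sup>2) \<le> (2 * L - real (Suc n)) * G n ?v"
        using True convex_potential.G_ge[OF potential v0 pb(2)] by (intro mult_left_mono) auto
      then show ?thesis using 1 pb(1) False by simp
    qed
  next
    case False
    then have "1 \<le> (real (Suc n) / (2 * L)) powr \<alpha>"
      using ge_one_powr_ge_zero[of "real (Suc n) / (2 * L)" \<alpha>] \<alpha> L0 by simp
    then have "q n \<le> 0" unfolding q using h0[of n] K_pos by (intro mult_nonneg_nonpos) auto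
    moreover have "n \<noteq> 0" using False L by (auto simp: of_nat_Suc)
    ultimately show ?thesis using p_nonneg[OF W(1), of n] by simp
  qed
  have "q sums (c0 * K - K * (2 * L) powr (- \<alpha>) * \<Gamma>)"
    unfolding q_def c0_def \<Gamma>_def
    by (intro sums_diff sums_mult2 sums_mult summable_sums summable_h0_sq summable_h0)
  then have sums: "(\<lambda>n. q n + (if n = 0 then K * \<kappa> * sqrt (K / L) else 0)) sums
      (c0 * K - K * (2 * L) powr (- \<alpha>) * \<Gamma> + K * \<kappa> * sqrt (K / L))"
    by (intro sums_add sums_single)
  have P: "c0 * K - K * (2 * L) powr (- \<alpha>) * \<Gamma> + K * \<kappa> * sqrt (K / L) \<le> P W"
    unfolding P_def by (rule sums_le[OF qp sums summable_sums[OF summable_p[OF W(1)]]])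
  \<comment> \<open>Taking out \<open>1 / sqrt L\<close> reduces the comparison of loss and gain to
    the choice of \<open>L\<close>.\<close>
  have "(2 * L) powr (- \<alpha>) * \<Gamma> \<le> L powr (- \<alpha>) * \<Gamma>"
    using L0 \<alpha> \<Gamma> by (intro mult_right_mono powr_mono2') auto
  also have "\<dots> = \<Gamma> * L powr (1/2 - \<alpha>) / sqrt L"
    using L0 powr_diff[of L "1/2 - \<alpha>" "1/2"] by (simp add: powr_half_sqrt mult.commute)
  also have "\<dots> < \<kappa> * sqrt K / sqrt L"
    using L L0 by (intro divide_strict_right_mono) auto
  also have "\<dots> = \<kappa> * sqrt (K / L)" by (simp add: real_sqrt_divide)
  finally have "K * ((2 * L) powr (- \<alpha>) * \<Gamma>) < K * (\<kappa> * sqrt (K / L))"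
    using K_pos by simp
  then have "c0 * K < P W" using P by (simp add: mult.assoc)
  then show ?thesis using W by blast
qed

text \<open>Mass of \<open>W j\<close> escaping to infinity, where \<open>A n (W j)\<close> is uniformly small, contributes to \<open>p n\<close> at most with the quadratic part of \<open>G n\<close>.\<close>

lemma p_limit_le:
  assumes W: "\<And>j. W j \<in> S" and NW: "\<And>j. L2norm_sq (W j) = 2 * K"
    and V: "V \<in> S" and lim: "AE x in lborel. (\<lambda>j. W j x) \<longlonglongrightarrow> V x" and \<omega>: "0 < \<omega>"
  shows "\<forall>\<^sub>F j in sequentially. p n (W j) < p n V + h n 0 * (real (Suc n))\<^sup>2 * (K - L2norm_sq V / 2) + \<omega>"
proof -
  define m where "m = real (Suc n)"
  define a where "a = h n 0"
  define N where "N = L2norm_sq V"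
  have m: "1 \<le> m" by (simp add: m_def)
  have a: "0 \<le> a" using convex_potential.h_0[OF potential] by (simp add: a_def)
  have N: "0 \<le> N" "N \<le> 2 * K" using V by (auto simp: N_def L2norm_sq_nonneg S_D)
  \<comment> \<open>\<open>C\<close> bounds the total factor that multiplies
    \<open>\<epsilon>\<close> in the final estimate.\<close>
  define C where "C = 2 + m\<^sup>2 * K + (a + 1) / 2 * m\<^sup>2"
  have C: "0 < C" using a K_pos by (auto simp: C_def intro!: add_pos_nonneg)
  define \<epsilon> where "\<epsilon> = min 1 (\<omega> / C)"
  have \<epsilon>: "0 < \<epsilon>" "\<epsilon> \<le> 1" "\<epsilon> * C \<le> \<omega>"
    using C \<omega> by (auto simp: \<epsilon>_def min_def field_simps)
  note [measurable] = unimodal_measurable[OF S_D(1)[OF V]] unimodal_measurable[OF S_D(1)[OF W]]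

  \<comment> \<open>Below amplitude \<open>u0\<close>, continuity of \<open>h n\<close> at 0 makes
    \<open>G n\<close> at most quadratic with coefficient
    \<open>(a + \<epsilon>) / 2\<close>.\<close>
  obtain u0 where u0: "0 < u0" "u0 \<le> b n" "h n u0 \<le> a + \<epsilon>"
  proof -
    have "\<forall>\<^sub>F u in at 0. h n u < a + \<epsilon>"
      using convex_potential.isCont_h_0[OF potential, of n] \<epsilon>(1) unfolding isCont_def a_def
      by (intro order_tendstoD(2)) auto
    then obtain d where d: "0 < d" "\<And>u. u \<noteq> 0 \<Longrightarrow> dist u 0 < d \<Longrightarrow> h n u < a + \<epsilon>"
      unfolding eventually_at by auto
    show ?thesis
    proof (rule that[of "min (d / 2) (b n)"])
      show pos: "0 < min (d / 2) (b n)" using d(1) b_pos[of n] by simp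
      have "dist (min (d / 2) (b n)) 0 < d"
        using pos d(1) unfolding dist_real_def by linarith
      moreover have "min (d / 2) (b n) \<noteq> 0" using pos by (metis less_irrefl)
      ultimately show "h n (min (d / 2) (b n)) \<le> a + \<epsilon>"
        by (intro less_imp_le[OF d(2)])
    qed simp
  qed

  have i: "integrable lborel (\<lambda>x. (V x)\<^sup>2)" by (intro L2R_integrable S_D V)
  \<comment> \<open>The radius \<open>k\<close> must meet two demands: \<open>V\<close> has nearly
    all its mass inside, and beyond it the decay of unimodal functions pushes the averages below
    \<open>u0\<close>.\<close>
  have "(\<lambda>k::nat. \<integral>x. indicator {- real k..real k} x * (V x)\<^sup>2 \<partial>lborel) \<longlonglongrightarrow> (\<integral>x. (V x)\<^sup>2 \<partial>lborel)"
  proof (rule integral_dominated_convergence[where w = "\<lambda>x. (V x)\<^sup>2"])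
    show "AE x in lborel. (\<lambda>k::nat. indicator {- real k..real k} x * (V x)\<^sup>2) \<longlonglongrightarrow> (V x)\<^sup>2"
    proof (rule AE_I2)
      fix x :: real
      have "\<forall>\<^sub>F k :: nat in sequentially. nat \<lceil>\<bar>x\<bar>\<rceil> \<le> k" by (rule eventually_ge_at_top)
      then have "\<forall>\<^sub>F k :: nat in sequentially. indicator {- real k..real k} x * (V x)\<^sup>2 = (V x)\<^sup>2"
        by eventually_elim (auto simp: indicator_def abs_le_iff nat_ceiling_le_eq)
      then show "(\<lambda>k::nat. indicator {- real k..real k} x * (V x)\<^sup>2) \<longlonglongrightarrow> (V x)\<^sup>2"
        by (rule tendsto_eventually)
    qed
    show "AE x in lborel. norm (indicator {- real k..real k} x * (V x)\<^sup>2) \<le> (V x)\<^sup>2" for k :: nat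
      by (auto simp: indicator_def)
  qed (use i in auto)
  then have "\<forall>\<^sub>F k :: nat in sequentially. N - \<epsilon> < (\<integral>x. indicator {- real k..real k} x * (V x)\<^sup>2 \<partial>lborel)"
    using \<epsilon>(1) by (intro order_tendstoD(1)) (auto simp: N_def L2norm_sq_def)
  moreover have "\<forall>\<^sub>F k :: nat in sequentially. nat \<lceil>m\<^sup>2 * K / u0\<^sup>2\<rceil> \<le> k" by (rule eventually_ge_at_top)
  ultimately have "\<forall>\<^sub>F k :: nat in sequentially. N - \<epsilon> < (\<integral>x. indicator {- real k..real k} x * (V x)\<^sup>2 \<partial>lborel)
      \<and> m\<^sup>2 * K / u0\<^sup>2 \<le> real k"
    by eventually_elim (auto simp: nat_ceiling_le_eq)
  then obtain k :: nat where k: "N - \<epsilon> < (\<integral>x. indicator {- real k..real k} x * (V x)\<^sup>2 \<partial>lborel)"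
    "m\<^sup>2 * K / u0\<^sup>2 \<le> real k"
    using eventually_happens'[OF trivial_limit_sequentially] by blast
  define \<rho> where "\<rho> = real k"
  \<comment> \<open>Half a window is added, so that windows centred outside \<open>[-R, R]\<close>
    do not meet \<open>[-\<rho>, \<rho>]\<close>.\<close>
  define R where "R = \<rho> + m / 2"
  have R: "0 < R" "m\<^sup>2 * K / u0\<^sup>2 \<le> R" using m k by (auto simp: R_def \<rho>_def)

  have A_small: "A n (W j) x \<le> u0" if "x \<in> - {-R..R}" for j x
  proof -
    have x: "R < \<bar>x\<bar>" using that by auto
    have "A n (W j) x \<le> sqrt (L2norm_sq (A n (W j)) / (2 * \<bar>x\<bar>))"
      using x R by (intro unimodal_bound A_unimodal A_L2 W) auto
    also have "\<dots> \<le> sqrt (m\<^sup>2 * (2 * K) / (2 * R))"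
      using A_L2(2)[OF W, of n j] x R K_pos
      by (intro real_sqrt_le_mono frac_le) (auto simp: m_def)
    also have "\<dots> \<le> sqrt (u0\<^sup>2)"
      using R u0 by (intro real_sqrt_le_mono) (simp add: field_simps)
    finally show ?thesis using u0 by simp
  qed

  \<comment> \<open>Outside \<open>[-R, R]\<close> the average sees only the part \<open>X\<close>
    of \<open>W j\<close> beyond \<open>\<rho>\<close>, so the mass of \<open>X\<close> alone
    enters.\<close>
  have outer: "(\<integral>x. indicator (- {-R..R}) x * G n (A n (W j) x) \<partial>lborel)
      \<le> (a + \<epsilon>) / 2 * m\<^sup>2 * (2 * K - (\<integral>x. indicator {-\<rho>..\<rho>} x * (W j x)\<^sup>2 \<partial>lborel))" for j
  proof -
    define X where "X = (\<lambda>t. indicator (- {-\<rho>..\<rho>}) t * W j t)"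
    have X: "X \<in> L2R" unfolding X_def by (intro L2R_restrict S_D W) auto
    have Wsq: "integrable lborel (\<lambda>x. (W j x)\<^sup>2)" by (intro L2R_integrable S_D W)
    have "L2norm_sq X = (\<integral>x. indicator (- {-\<rho>..\<rho>}) x * (W j x)\<^sup>2 \<partial>lborel)"
      unfolding L2norm_sq_def X_def by (intro Bochner_Integration.integral_cong) (auto simp: indicator_def)
    then have NX: "L2norm_sq X = 2 * K - (\<integral>x. indicator {-\<rho>..\<rho>} x * (W j x)\<^sup>2 \<partial>lborel)"
      using integral_split_indicator[OF _ Wsq, of "{-\<rho>..\<rho>}"] NW[of j] by (simp add: L2norm_sq_def)
    have AX: "A n (W j) x = A n X x" if "x \<in> - {-R..R}" for x
      unfolding Aop_eq using that
      by (intro Bochner_Integration.integral_cong) (auto simp: X_def indicator_def R_def m_def)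
    have "(\<integral>x. indicator (- {-R..R}) x * G n (A n (W j) x) \<partial>lborel) \<le> (\<integral>x. (a + \<epsilon>) / 2 * (A n X x)\<^sup>2 \<partial>lborel)"
    proof (rule integral_mono)
      show "integrable lborel (\<lambda>x. indicator (- {-R..R}) x * G n (A n (W j) x))"
        by (intro integrable_mult_indicator_real integrable_G_A W) auto
      show "integrable lborel (\<lambda>x. (a + \<epsilon>) / 2 * (A n X x)\<^sup>2)"
        by (intro integrable_mult_right L2R_integrable Aop_L2 X)
      fix x
      show "indicator (- {-R..R}) x * G n (A n (W j) x) \<le> (a + \<epsilon>) / 2 * (A n X x)\<^sup>2"
      proof (cases "x \<in> - {-R..R}")
        case True
        have "G n (A n (W j) x) \<le> h n u0 / 2 * (A n (W j) x)\<^sup>2"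
          by (rule convex_potential.G_le[OF potential A_nonneg[OF W] A_small[OF True] u0(2)])
        also have "\<dots> \<le> (a + \<epsilon>) / 2 * (A n (W j) x)\<^sup>2"
          using u0 by (intro mult_right_mono) auto
        finally show ?thesis using True AX[OF True] by simp
      next
        case False
        then show ?thesis using a \<epsilon> by simp
      qed
    qed
    also have "\<dots> = (a + \<epsilon>) / 2 * L2norm_sq (A n X)" by (simp add: L2norm_sq_def)
    also have "\<dots> \<le> (a + \<epsilon>) / 2 * (m\<^sup>2 * L2norm_sq X)"
      unfolding m_def using a \<epsilon> by (intro mult_left_mono Aop_L2 X) auto
    finally show ?thesis by (simp add: NX mult.assoc)
  qed

  \<comment> \<open>By Fatou nearly the mass of \<open>V\<close> remains inside, hence at most
    \<open>2 * K - N + \<epsilon>\<close> can be outside.\<close>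
  have "\<forall>\<^sub>F j in sequentially. N - \<epsilon> < (\<integral>x. indicator {-\<rho>..\<rho>} x * (W j x)\<^sup>2 \<partial>lborel)"
  proof (rule Fatou_real_less)
    show "AE x in lborel. (\<lambda>j. indicator {- \<rho>..\<rho>} x * (W j x)\<^sup>2) \<longlonglongrightarrow> indicator {- \<rho>..\<rho>} x * (V x)\<^sup>2"
      using lim by eventually_elim (intro tendsto_intros)
    show "N - \<epsilon> < (\<integral>x. indicator {- \<rho>..\<rho>} x * (V x)\<^sup>2 \<partial>lborel)" using k(1) by (simp add: \<rho>_def)
  qed (auto intro!: integrable_mult_indicator_real L2R_integrable S_D V W)
  \<comment> \<open>On the compact part the averages converge pointwise and \<open>G n (b n)\<close>
    dominates.\<close>
  moreover have "\<forall>\<^sub>F j in sequentially. (\<integral>x. indicator {-R..R} x * G n (A n (W j) x) \<partial>lborel) < p n V + \<epsilon>"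
  proof (rule order_tendstoD(2))
    show "(\<lambda>j. \<integral>x. indicator {-R..R} x * G n (A n (W j) x) \<partial>lborel) \<longlonglongrightarrow> (\<integral>x. indicator {-R..R} x * G n (A n V x) \<partial>lborel)"
    proof (rule integral_dominated_convergence)
      show "integrable lborel (\<lambda>x. indicator {-R..R} x * G n (b n))"
        by (intro integrable_mult_left integrable_indicator_Icc)
      show "(\<lambda>x. indicator {-R..R} x * G n (A n V x)) \<in> borel_measurable lborel"
        "(\<lambda>x. indicator {-R..R} x * G n (A n (W j) x)) \<in> borel_measurable lborel" for j
        using unimodal_measurable[OF unimodal_G_A[OF V, of n]] unimodal_measurable[OF unimodal_G_A[OF W, of n j]]
        by measurable
      show "AE x in lborel. (\<lambda>j. indicator {-R..R} x * G n (A n (W j) x)) \<longlonglongrightarrow> indicator {-R..R} x * G n (A n V x)"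
      proof (rule AE_I2)
        fix x
        have "(\<lambda>j. A n (W j) x) \<longlonglongrightarrow> A n V x"
          by (rule Aop_tendsto[OF _ _ _ _ lim]) (auto intro: S_D W V)
        moreover have "isCont (G n) (A n V x)"
          by (rule DERIV_isCont[OF convex_potential.DERIV_G[OF potential A_nonneg[OF V] A_le_b[OF V]]])
        ultimately have "(\<lambda>j. G n (A n (W j) x)) \<longlonglongrightarrow> G n (A n V x)"
          by (rule isCont_tendsto_compose[rotated])
        then show "(\<lambda>j. indicator {-R..R} x * G n (A n (W j) x)) \<longlonglongrightarrow> indicator {-R..R} x * G n (A n V x)"
          by (intro tendsto_intros)
      qed
      show "AE x in lborel. norm (indicator {-R..R} x * G n (A n (W j) x)) \<le> indicator {-R..R} x * G n (b n)" for j
        using convex_potential.G_mono[OF potential A_nonneg[OF W] A_le_b[OF W] order_refl] unimodal_nonneg[OF unimodal_G_A[OF W]]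
        by (intro AE_I2) (auto simp: indicator_def)
    qed
    have "(\<integral>x. indicator {-R..R} x * G n (A n V x) \<partial>lborel) \<le> p n V"
      unfolding p_def using unimodal_nonneg[OF unimodal_G_A[OF V]]
      by (intro integral_mono integrable_mult_indicator_real integrable_G_A V) (auto simp: indicator_def)
    then show "(\<integral>x. indicator {-R..R} x * G n (A n V x) \<partial>lborel) < p n V + \<epsilon>"
      using \<epsilon> by simp
  qed
  ultimately show ?thesis
  proof eventually_elim
    case (elim j)
    have "p n (W j) = (\<integral>x. indicator {-R..R} x * G n (A n (W j) x) \<partial>lborel) + (\<integral>x. indicator (- {-R..R}) x * G n (A n (W j) x) \<partial>lborel)"
      unfolding p_def by (intro integral_split_indicator integrable_G_A W) auto
    also have "\<dots> < p n V + \<epsilon> + (a + \<epsilon>) / 2 * m\<^sup>2 * (2 * K - (\<integral>x. indicator {-\<rho>..\<rho>} x * (W j x)\<^sup>2 \<partial>lborel))"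
      using elim(2) outer[of j] by simp
    also have "\<dots> \<le> p n V + \<epsilon> + (a + \<epsilon>) / 2 * m\<^sup>2 * (2 * K - (N - \<epsilon>))"
      using elim(1) a \<epsilon> by (intro add_left_mono mult_left_mono) auto
    also have "\<dots> = p n V + a * m\<^sup>2 * (K - N / 2) + \<epsilon> * (1 + m\<^sup>2 * (K - N / 2) + (a + \<epsilon>) / 2 * m\<^sup>2)"
      by (simp add: field_simps)
    also have "\<dots> \<le> p n V + a * m\<^sup>2 * (K - N / 2) + \<epsilon> * C"
      unfolding C_def using N \<epsilon>
      by (intro add_left_mono mult_left_mono add_mono mult_right_mono divide_right_mono) auto
    finally show ?case using \<epsilon>(3) by (simp add: a_def m_def N_def)
  qed
qed

text \<open>\<open>p_limit_le\<close> is summed over \<open>n\<close> by Tannery's theorem, with the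
  multiples of \<open>E n\<close> as majorant.\<close>

lemma P_limit_le:
  assumes W: "\<And>j. W j \<in> S" and NW: "\<And>j. L2norm_sq (W j) = 2 * K"
    and V: "V \<in> S" and lim: "AE x in lborel. (\<lambda>j. W j x) \<longlonglongrightarrow> V x"
    and M: "(\<lambda>j. P (W j)) \<longlonglongrightarrow> M"
  shows "M \<le> P V + c0 * (K - L2norm_sq V / 2)"
proof -
  define q where "q n = p n V + h n 0 * (real (Suc n))\<^sup>2 * (K - L2norm_sq V / 2)" for n
  have q: "0 \<le> q n" for n
    unfolding q_def using convex_potential.h_0[OF potential, of n] p_nonneg[OF V] S_D(3)[OF V]
    by (intro add_nonneg_nonneg mult_nonneg_nonneg) auto
  have q_sums: "q sums (P V + c0 * (K - L2norm_sq V / 2))"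
    unfolding q_def P_def c0_def
    by (intro sums_add sums_mult2 summable_sums summable_h0_sq summable_p V)
  \<comment> \<open>Only an upper bound on the limit superior of \<open>p n (W j)\<close> is
    available; taking the maximum with \<open>q n\<close> turns it into a genuine limit.\<close>
  have lim_max: "(\<lambda>j. max (p n (W j)) (q n)) \<longlonglongrightarrow> q n" for n
  proof (rule order_tendstoI)
    fix y assume "y < q n"
    then show "\<forall>\<^sub>F j in sequentially. y < max (p n (W j)) (q n)"
      by (intro always_eventually) auto
  next
    fix y assume y: "q n < y"
    have "\<forall>\<^sub>F j in sequentially. p n (W j) < q n + (y - q n)"
      unfolding q_def using y q_def by (intro p_limit_le W NW V lim) auto
    then show "\<forall>\<^sub>F j in sequentially. max (p n (W j)) (q n) < y"
      by eventually_elim (use y in auto)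
  qed
  have bound: "norm (max (p n (W j)) (q n)) \<le> E n * K + q n" for n j
    using p_le[OF W, of n j] p_nonneg[OF W, of n j] q[of n] E_nonneg[of n] K_pos by (auto simp: max_def)
  have sum: "summable (\<lambda>n. E n * K + q n)"
    using q_sums by (intro summable_add summable_mult2 summable_h) (auto simp: sums_iff)
  have ev: "\<forall>\<^sub>F (n, j) in at_top \<times>\<^sub>F sequentially. norm (max (p n (W j)) (q n)) \<le> E n * K + q n"
    using bound by (intro always_eventually) auto
  have "(\<lambda>j. \<Sum>n. max (p n (W j)) (q n)) \<longlonglongrightarrow> (\<Sum>n. q n)"
    using tannerys_theorem[OF lim_max ev sum] by simp
  moreover have "P (W j) \<le> (\<Sum>n. max (p n (W j)) (q n))" for j
    unfolding P_def
    by (intro suminf_le summable_p W summable_comparison_test[OF _ sum]) (use bound in \<open>auto intro!: exI[of _ 0]\<close>)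
  ultimately have "M \<le> (\<Sum>n. q n)"
    using M by (intro LIMSEQ_le[of "\<lambda>j. P (W j)"]) auto
  then show ?thesis using q_sums by (simp add: sums_iff)
qed

text \<open>Restoring the full norm multiplies by some \<open>s \<ge> 1\<close>; averaging is
  linear, so \<open>G_scale\<close> applies to each term.\<close>

lemma P_scale:
  assumes W: "W \<in> S" and N: "0 < L2norm_sq W"
  defines "s \<equiv> sqrt (2 * K / L2norm_sq W)"
  shows "(\<lambda>x. s * W x) \<in> S" "L2norm_sq (\<lambda>x. s * W x) = 2 * K" "s\<^sup>2 * P W \<le> P (\<lambda>x. s * W x)"
proof -
  have s: "1 \<le> s" using N S_D(3)[OF W] by (simp add: s_def)
  have s2: "s\<^sup>2 = 2 * K / L2norm_sq W" using N K_pos by (simp add: s_def)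
  show N': "L2norm_sq (\<lambda>x. s * W x) = 2 * K"
    using N by (simp add: L2norm_sq_cmult s2)
  then show sW: "(\<lambda>x. s * W x) \<in> S"
    using s by (simp add: S_def L2R_cmult unimodal_cmult S_D[OF W])
  have "s\<^sup>2 * p n W \<le> p n (\<lambda>x. s * W x)" for n
  proof -
    have "s\<^sup>2 * p n W = (\<integral>x. s\<^sup>2 * G n (A n W x) \<partial>lborel)"
      by (simp add: p_def)
    also have "\<dots> \<le> p n (\<lambda>x. s * W x)"
      unfolding p_def
    proof (rule integral_mono)
      fix x
      have "s * A n W x \<le> b n" using A_le_b[OF sW, of n x] by (simp add: Aop_cmult)
      then show "s\<^sup>2 * G n (A n W x) \<le> G n (A n (\<lambda>x. s * W x) x)"
        using convex_potential.G_scale[OF potential s A_nonneg[OF W]] by (simp add: Aop_cmult)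
    qed (auto intro!: integrable_G_A W sW)
    finally show ?thesis .
  qed
  then have "(\<Sum>n. s\<^sup>2 * p n W) \<le> P (\<lambda>x. s * W x)"
    unfolding P_def by (intro suminf_le summable_mult summable_p W sW)
  then show "s\<^sup>2 * P W \<le> P (\<lambda>x. s * W x)"
    unfolding P_def by (simp add: suminf_mult summable_p W)
qed

lemma maximizer:
  "\<exists>W\<in>S. L2norm_sq W = 2 * K \<and> 0 < P W \<and> (\<forall>V\<in>S. L2norm_sq V = 2 * K \<longrightarrow> P V \<le> P W)"
proof -
  define T where "T = {W \<in> S. L2norm_sq W = 2 * K}"
  define M where "M = Sup (P ` T)"
  obtain W0 where W0: "W0 \<in> T" "c0 * K < P W0" using threshold by (auto simp: T_def)
  have bdd: "bdd_above (P ` T)"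
    using P_le by (intro bdd_aboveI[of _ "\<Sum>n. E n * K"]) (auto simp: T_def)
  have P_M: "P W \<le> M" if "W \<in> T" for W
    unfolding M_def using that bdd by (intro cSup_upper) auto
  have M: "c0 * K < M" using W0 P_M[OF W0(1)] by simp
  have c0: "0 \<le> c0"
    unfolding c0_def using convex_potential.h_0[OF potential] by (intro suminf_nonneg summable_h0_sq) auto
  have "\<exists>W\<in>T. M - 1 / real (Suc j) < P W" for j
    unfolding M_def using W0 less_cSupD[of "P ` T" "Sup (P ` T) - 1 / real (Suc j)"] by auto
  then obtain W where W: "\<And>j. W j \<in> T" "\<And>j. M - 1 / real (Suc j) < P (W j)"
    by metis
  have WS: "W j \<in> S" "L2norm_sq (W j) = 2 * K" for j using W(1) by (auto simp: T_def)
  have lim_P: "(\<lambda>j. P (W j)) \<longlonglongrightarrow> M"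
  proof (rule tendsto_sandwich[of "\<lambda>j. M - 1 / real (Suc j)" _ _ "\<lambda>_. M"])
    have "(\<lambda>j. M - 1 / real (Suc j)) \<longlonglongrightarrow> M - 0"
      using LIMSEQ_inverse_real_of_nat by (intro tendsto_diff tendsto_const) (simp add: inverse_eq_divide)
    then show "(\<lambda>j. M - 1 / real (Suc j)) \<longlonglongrightarrow> M" by simp
  qed (use W P_M in \<open>auto intro!: always_eventually less_imp_le\<close>)
  obtain s V where s: "strict_mono (s :: nat \<Rightarrow> nat)" and V: "unimodal V"
    and lim: "AE x in lborel. (\<lambda>j. W (s j) x) \<longlonglongrightarrow> V x"
    using unimodal_selection[of W "2 * K"] S_D[OF WS(1)] by blast
  have VS: "V \<in> S"
    using L2_Fatou[OF _ _ unimodal_measurable[OF V] lim, of "2 * K"] S_D[OF WS(1)] V by (auto simp: S_def)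
  have "(\<lambda>j. P (W (s j))) \<longlonglongrightarrow> M"
    using LIMSEQ_subseq_LIMSEQ[OF lim_P s] by (simp add: comp_def)
  from P_limit_le[OF WS VS lim this]
  have le: "M \<le> P V + c0 * (K - L2norm_sq V / 2)" .
  have "L2norm_sq V \<noteq> 0"
  proof
    \<comment> \<open>A limit of norm 0 has \<open>P V = 0\<close>, leaving
      \<open>M \<le> c0 * K\<close>, against the strict threshold.\<close>
    assume N: "L2norm_sq V = 0"
    have "p n V = 0" for n using p_le_norm[OF VS, of n] p_nonneg[OF VS, of n] N by simp
    then show False using le N M by (simp add: P_def)
  qed
  then have N: "0 < L2norm_sq V" using L2norm_sq_nonneg[of V] by simp
  \<comment> \<open>\<open>\<theta>\<close> is the fraction of mass retained. Scaling gives
    \<open>P V \<le> \<theta> * M\<close>, the lost mass contributes at most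
    \<open>c0 * K * (1 - \<theta>)\<close>, and \<open>M > c0 * K\<close> forces
    \<open>\<theta> = 1\<close>.\<close>
  define \<theta> where "\<theta> = L2norm_sq V / (2 * K)"
  have \<theta>: "0 < \<theta>" "\<theta> \<le> 1" using N S_D(3)[OF VS] K_pos by (auto simp: \<theta>_def)
  have "(sqrt (2 * K / L2norm_sq V))\<^sup>2 * P V \<le> M"
    using P_scale[OF VS N] P_M by (force simp: T_def)
  moreover have "(sqrt (2 * K / L2norm_sq V))\<^sup>2 = 1 / \<theta>"
    using N K_pos by (simp add: \<theta>_def)
  ultimately have "1 / \<theta> * P V \<le> M" by (simp only:)
  then have PV: "P V \<le> \<theta> * M"
    using \<theta> by (simp add: field_simps)
  have "c0 * (K - L2norm_sq V / 2) = c0 * K * (1 - \<theta>)"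
    using K_pos by (simp add: \<theta>_def field_simps)
  then have "M \<le> \<theta> * M + c0 * K * (1 - \<theta>)"
    using le PV by linarith
  then have "M * (1 - \<theta>) \<le> c0 * K * (1 - \<theta>)"
    by (simp add: algebra_simps)
  then have "(M - c0 * K) * (1 - \<theta>) \<le> 0"
    by (simp add: algebra_simps)
  then have "\<theta> = 1"
    using M \<theta> by (simp add: mult_le_0_iff)
  then have NV: "L2norm_sq V = 2 * K" using K_pos by (simp add: \<theta>_def)
  then have "M \<le> P V" using le by simp
  moreover have "0 < M" using M mult_nonneg_nonneg[OF c0, of K] K_pos by linarith
  ultimately show ?thesis
    using VS NV P_M by (intro bexI[of _ V]) (auto simp: T_def intro: order_trans less_le_trans)
qed

end

section \<open>The Euler-Lagrange equation\<close>

lemma unimodal_truncate: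
  assumes U: "unimodal U"
  shows "unimodal (\<lambda>x. indicator {-R..R} x * U x)"
proof (rule unimodalI)
  fix x y :: real assume xy: "0 < x" "x \<le> y"
  show "indicator {-R..R} y * U y \<le> indicator {-R..R} x * U x"
    using xy unimodal_antimono[OF U xy] unimodal_nonneg[OF U, of x] by (auto simp: indicator_def)
qed (use unimodal_minus[OF U] unimodal_nonneg[OF U] in \<open>auto simp: indicator_def\<close>)

context potential_family
begin

section \<open>The gradient of the functional at an admissible function\<close>

context
  fixes W :: "real \<Rightarrow> real"
  assumes W: "W \<in> S"
begin

abbreviation grad :: "nat \<Rightarrow> real \<Rightarrow> real" where
  "grad n \<equiv> \<lambda>\<xi>. g n (A n W \<xi>)"

text \<open>Formally the gradient of \<open>P\<close> at \<open>W\<close>: the outer average is the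
  adjoint of the inner one.\<close>

definition U :: "real \<Rightarrow> real" where
  "U x = (\<Sum>n. A n (grad n) x)"

text \<open>Formally the derivative of \<open>p n\<close> at \<open>W\<close> in direction
  \<open>V\<close>.\<close>

definition D :: "nat \<Rightarrow> (real \<Rightarrow> real) \<Rightarrow> real" where
  "D n V = (\<integral>x. grad n x * A n V x \<partial>lborel)"

lemma grad_nonneg: "0 \<le> grad n x"
  by (rule unimodal_nonneg[OF unimodal_g_A[OF W]])

lemma grad_measurable: "grad n \<in> borel_measurable borel"
  by (rule unimodal_measurable[OF unimodal_g_A[OF W]])

lemma grad_le: "grad n x \<le> h n (b n) * A n W x"
  by (rule convex_potential.g_le[OF potential A_nonneg[OF W] A_le_b[OF W] order_refl])

lemma grad_L2: "grad n \<in> L2R"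
proof -
  have "integrable lborel (\<lambda>x. (grad n x)\<^sup>2)"
  proof (rule Bochner_Integration.integrable_bound)
    show "integrable lborel (\<lambda>x. (h n (b n) * A n W x)\<^sup>2)"
      by (intro L2R_integrable L2R_cmult A_L2 W)
    show "(\<lambda>x. (grad n x)\<^sup>2) \<in> borel_measurable lborel"
      using grad_measurable[of n] by measurable
    show "AE x in lborel. norm ((grad n x)\<^sup>2) \<le> norm ((h n (b n) * A n W x)\<^sup>2)"
      using power_mono[OF grad_le grad_nonneg, where n = 2] by auto
  qed
  then show ?thesis using grad_measurable[of n] by (simp add: L2R_def)
qed

lemma A_grad_unimodal: "unimodal (A n (grad n))"
  by (intro unimodal_Aop unimodal_g_A W L2R_win_integrable grad_L2)

text \<open>The gradient is at most \<open>h n (b n) * b n\<close> and the window has length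
  \<open>m\<close>; together this is of order \<open>m powr (3/2)\<close>, which is at most
  \<open>m\<^sup>2\<close>.\<close>

lemma A_grad_le: "A n (grad n) x \<le> E n * sqrt (2 * K)"
proof -
  have "A n (grad n) x \<le> A n (\<lambda>_. h n (b n) * b n) x"
  proof (rule Aop_mono)
    show "grad n t \<le> h n (b n) * b n" for t
      using grad_le[of n t] mult_left_mono[OF A_le_b[OF W, of n t] h_b_nonneg] by (rule order_trans)
    show "integrable lborel (\<lambda>t. indicator (win (Suc n) x) t * grad n t)"
      by (intro L2R_win_integrable grad_L2)
    show "integrable lborel (\<lambda>t. indicator (win (Suc n) x) t * (h n (b n) * b n))"
      by (rule integrable_mult_left, rule integrable_real_indicator) auto
  qed
  also have "\<dots> = h n (b n) * (real (Suc n) * sqrt (real (Suc n))) * sqrt (2 * K)"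
    by (simp add: Aop_const real_sqrt_mult)
  also have "\<dots> \<le> h n (b n) * (real (Suc n) * real (Suc n)) * sqrt (2 * K)"
    using h_b_nonneg K_pos real_sqrt_le_mono[of 1 "real (Suc n)"]
    by (intro mult_right_mono mult_left_mono) (auto simp: of_nat_Suc intro!: real_le_lsqrt simp: power2_eq_square algebra_simps)
  finally show ?thesis by (simp add: power2_eq_square)
qed

lemma A_grad_summable: "summable (\<lambda>n. A n (grad n) x)"
  using A_grad_le unimodal_nonneg[OF A_grad_unimodal]
  by (intro summable_comparison_test[OF _ summable_mult2[OF summable_h, of "sqrt (2 * K)"]]) (auto intro!: exI[of _ 0])

lemma U_unimodal: "unimodal U"
proof (rule unimodalI)
  show "U (- x) = U x" for x
    by (simp add: U_def unimodal_minus[OF A_grad_unimodal])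
  show "0 \<le> U x" for x
    unfolding U_def by (intro suminf_nonneg A_grad_summable unimodal_nonneg[OF A_grad_unimodal])
  show "U y \<le> U x" if "0 < x" "x \<le> y" for x y
    unfolding U_def by (intro suminf_le A_grad_summable unimodal_antimono[OF A_grad_unimodal] that)
qed

lemma U_le: "U x \<le> (\<Sum>n. E n * sqrt (2 * K))"
  unfolding U_def by (intro suminf_le A_grad_le A_grad_summable summable_mult2 summable_h)

lemma D_integrable: "V \<in> L2R \<Longrightarrow> integrable lborel (\<lambda>x. grad n x * A n V x)"
  by (intro L2R_mult_integrable grad_L2 Aop_L2)

lemma D_nonneg: "unimodal V \<Longrightarrow> 0 \<le> D n V"
  unfolding D_def by (rule Bochner_Integration.integral_nonneg) (simp add: grad_nonneg Aop_nonneg unimodal_nonneg)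

text \<open>The gradient is linearly bounded by \<open>A n W\<close>; the product is then split into
  squares by \<open>2 * u * v \<le> u\<^sup>2 + v\<^sup>2\<close>.\<close>

lemma D_le:
  assumes V: "unimodal V" "V \<in> L2R"
  shows "D n V \<le> E n * (K + L2norm_sq V / 2)"
proof -
  note AV = Aop_L2[OF V(2), of "Suc n"]
  have "D n V \<le> (\<integral>x. h n (b n) / 2 * ((A n W x)\<^sup>2 + (A n V x)\<^sup>2) \<partial>lborel)"
    unfolding D_def
  proof (rule integral_mono)
    show "integrable lborel (\<lambda>x. h n (b n) / 2 * ((A n W x)\<^sup>2 + (A n V x)\<^sup>2))"
      by (intro integrable_mult_right Bochner_Integration.integrable_add L2R_integrable A_L2 W AV)
    fix x
    have "grad n x * A n V x \<le> (h n (b n) * A n W x) * A n V x"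
      by (intro mult_right_mono grad_le Aop_nonneg unimodal_nonneg[OF V(1)])
    also have "\<dots> = h n (b n) / 2 * (2 * A n W x * A n V x)" by simp
    also have "\<dots> \<le> h n (b n) / 2 * ((A n W x)\<^sup>2 + (A n V x)\<^sup>2)"
      using h_b_nonneg by (intro mult_left_mono sum_squares_bound) auto
    finally show "grad n x * A n V x \<le> h n (b n) / 2 * ((A n W x)\<^sup>2 + (A n V x)\<^sup>2)" .
  qed (rule D_integrable[OF V(2)])
  also have "\<dots> = h n (b n) / 2 * (L2norm_sq (A n W) + L2norm_sq (A n V))"
    using L2R_integrable[OF A_L2(1)[OF W]] L2R_integrable[OF AV(1)] by (simp add: L2norm_sq_def)
  also have "\<dots> \<le> h n (b n) / 2 * ((real (Suc n))\<^sup>2 * (2 * K) + (real (Suc n))\<^sup>2 * L2norm_sq V)"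
    using h_b_nonneg by (intro mult_left_mono add_mono A_L2 W AV) auto
  finally show ?thesis by (simp add: algebra_simps)
qed

lemma D_summable:
  assumes V: "unimodal V" "V \<in> L2R"
  shows "summable (\<lambda>n. D n V)"
  using D_le[OF V] D_nonneg[OF V(1)]
  by (intro summable_comparison_test[OF _ summable_mult2[OF summable_h, of "K + L2norm_sq V / 2"]]) (auto intro!: exI[of _ 0])

text \<open>All terms are nonnegative, so sum and integral may be exchanged and the average moved
  onto \<open>V\<close>; finiteness of the resulting sum then yields integrability.\<close>

lemma U_pairing:
  assumes V: "unimodal V" "V \<in> L2R"
  shows "integrable lborel (\<lambda>x. U x * V x)" "(\<integral>x. U x * V x \<partial>lborel) = (\<Sum>n. D n V)"
proof -
  note [measurable] = unimodal_measurable[OF V(1)] unimodal_measurable[OF U_unimodal]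
    unimodal_measurable[OF A_grad_unimodal]
  have "(\<integral>\<^sup>+x. ennreal (U x * V x) \<partial>lborel) = (\<integral>\<^sup>+x. (\<Sum>n. ennreal (A n (grad n) x * V x)) \<partial>lborel)"
  proof (rule nn_integral_cong)
    fix x
    have "U x * V x = (\<Sum>n. A n (grad n) x * V x)"
      unfolding U_def by (rule suminf_mult2[OF A_grad_summable])
    then show "ennreal (U x * V x) = (\<Sum>n. ennreal (A n (grad n) x * V x))"
      by (simp only:) (intro suminf_ennreal2[symmetric] mult_nonneg_nonneg unimodal_nonneg[OF V(1)]
        unimodal_nonneg[OF A_grad_unimodal] summable_mult2 A_grad_summable)
  qed
  also have "\<dots> = (\<Sum>n. \<integral>\<^sup>+x. ennreal (A n (grad n) x * V x) \<partial>lborel)"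
    by (rule nn_integral_suminf) measurable
  also have "\<dots> = (\<Sum>n. ennreal (D n V))"
  proof (rule arg_cong[where f = suminf], rule ext)
    fix n
    have "(\<integral>\<^sup>+x. ennreal (A n (grad n) x * V x) \<partial>lborel) = (\<integral>\<^sup>+x. ennreal (grad n x * A n V x) \<partial>lborel)"
      by (intro Aop_adjoint grad_measurable unimodal_measurable[OF V(1)] grad_nonneg unimodal_nonneg[OF V(1)]
          L2R_win_integrable grad_L2 V(2))
    also have "\<dots> = ennreal (D n V)"
      unfolding D_def
      by (intro nn_integral_eq_integral D_integrable V(2) AE_I2 mult_nonneg_nonneg grad_nonneg Aop_nonneg unimodal_nonneg[OF V(1)])
    finally show "(\<integral>\<^sup>+x. ennreal (A n (grad n) x * V x) \<partial>lborel) = ennreal (D n V)" .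
  qed
  also have "\<dots> = ennreal (\<Sum>n. D n V)"
    by (intro suminf_ennreal2 D_nonneg D_summable V)
  finally have eq: "(\<integral>\<^sup>+x. ennreal (U x * V x) \<partial>lborel) = ennreal (\<Sum>n. D n V)" .
  have nn: "0 \<le> U x * V x" for x
    by (intro mult_nonneg_nonneg unimodal_nonneg[OF U_unimodal] unimodal_nonneg[OF V(1)])
  have "0 \<le> (\<Sum>n. D n V)" by (intro suminf_nonneg D_summable D_nonneg V)
  then have "has_bochner_integral lborel (\<lambda>x. U x * V x) (\<Sum>n. D n V)"
    by (intro has_bochner_integral_nn_integral) (auto simp: nn eq)
  then show "integrable lborel (\<lambda>x. U x * V x)" "(\<integral>x. U x * V x \<partial>lborel) = (\<Sum>n. D n V)"
    by (auto simp: has_bochner_integral_iff)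
qed

text \<open>By \<open>U_pairing\<close> this is the integral of \<open>U * W\<close>;
  \<open>T / (2 * K)\<close> will be the Lagrange multiplier.\<close>

definition T :: real where "T = (\<Sum>n. D n W)"

section \<open>Consequences of maximality\<close>

context
  assumes NW: "L2norm_sq W = 2 * K" and PW: "0 < P W"
    and max: "\<And>V. V \<in> S \<Longrightarrow> L2norm_sq V = 2 * K \<Longrightarrow> P V \<le> P W"
begin

text \<open>Convexity with \<open>G n 0 = 0\<close> gives \<open>G n u \<le> g n u * u\<close>,
  hence \<open>P W \<le> T\<close>.\<close>

lemma T_pos: "0 < T"
proof -
  have "p n W \<le> D n W" for n
    unfolding p_def D_def
    using convex_potential.G_le_mult_g[OF potential A_nonneg[OF W] A_le_b[OF W]]
    by (intro integral_mono integrable_G_A D_integrable S_D(2)[OF W] W)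
  then have "P W \<le> T"
    unfolding P_def T_def by (intro suminf_le summable_p D_summable S_D W)
  then show ?thesis using PW by simp
qed

text \<open>The tangent inequality, integrated and summed, bounds
  \<open>P W + ((\<Sum>n. D n V) - T)\<close> by \<open>P V\<close>, which maximality bounds by
  \<open>P W\<close>.\<close>

lemma D_le_T:
  assumes V: "V \<in> S" "L2norm_sq V = 2 * K"
  shows "(\<Sum>n. D n V) \<le> T"
proof -
  have "p n W + (D n V - D n W) \<le> p n V" for n
  proof -
    have "p n W + (D n V - D n W) = (\<integral>x. G n (A n W x) + (grad n x * A n V x - grad n x * A n W x) \<partial>lborel)"
      unfolding p_def D_def
      using integrable_G_A[OF W, of n] D_integrable[OF S_D(2)[OF V(1)], of n] D_integrable[OF S_D(2)[OF W], of n] by simp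
    also have "\<dots> \<le> p n V"
      unfolding p_def
    proof (rule integral_mono)
      fix x
      show "G n (A n W x) + (grad n x * A n V x - grad n x * A n W x) \<le> G n (A n V x)"
        using convex_potential.G_convex[OF potential A_nonneg[OF W] A_le_b[OF W] A_nonneg[OF V(1)] A_le_b[OF V(1)], of n x x]
        by (simp add: right_diff_distrib)
    qed (intro Bochner_Integration.integrable_add Bochner_Integration.integrable_diff integrable_G_A D_integrable S_D(2) W V(1))+
    finally show ?thesis .
  qed
  note le = this
  have sV: "summable (\<lambda>n. D n V)" and sW: "summable (\<lambda>n. D n W)"
    using D_summable[OF S_D(1,2)[OF V(1)]] D_summable[OF S_D(1,2)[OF W]] by auto
  have "(\<Sum>n. p n W + (D n V - D n W)) \<le> P V"
    unfolding P_def using le by (intro suminf_le summable_add summable_diff summable_p W V sV sW)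
  moreover have "(\<Sum>n. p n W + (D n V - D n W)) = P W + ((\<Sum>n. D n V) - T)"
    unfolding P_def T_def
    by (simp add: suminf_add[symmetric] suminf_diff[symmetric] summable_diff summable_p W sV sW)
  ultimately show ?thesis using max[OF V] by simp
qed

text \<open>\<open>U\<close> cannot be tested against itself before it is known to be
  square-integrable. Its truncations are bounded, unimodal and of compact support, hence admissible
  after rescaling; testing with them bounds their norms uniformly, and Fatou passes to
  \<open>U\<close>.\<close>

lemma U_L2: "U \<in> L2R" "L2norm_sq U \<le> T\<^sup>2 / (2 * K)"
proof -
  define V where "V k = (\<lambda>x. indicator {- real k..real k} x * U x)" for k :: nat
  have uV: "unimodal (V k)" for k
    unfolding V_def by (rule unimodal_truncate[OF U_unimodal])
  define C where "C = (\<Sum>n. E n * sqrt (2 * K))"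
  have V: "V k \<in> L2R" for k
  proof -
    have "integrable lborel (\<lambda>x. (V k x)\<^sup>2)"
    proof (rule Bochner_Integration.integrable_bound)
      show "integrable lborel (\<lambda>x. indicator {- real k..real k} x * C\<^sup>2)"
        by (intro integrable_mult_left integrable_indicator_Icc)
      show "(\<lambda>x. (V k x)\<^sup>2) \<in> borel_measurable lborel"
        using unimodal_measurable[OF uV[of k]] by measurable
      show "AE x in lborel. norm ((V k x)\<^sup>2) \<le> norm (indicator {- real k..real k} x * C\<^sup>2)"
        using power_mono[OF U_le unimodal_nonneg[OF U_unimodal], where n = 2]
        by (intro AE_I2) (auto simp: V_def indicator_def C_def)
    qed
    then show ?thesis using unimodal_measurable[OF uV[of k]] by (simp add: L2R_def)
  qed
  have NV: "L2norm_sq (V k) \<le> T\<^sup>2 / (2 * K)" for k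
  proof (cases "L2norm_sq (V k) = 0")
    case True
    then show ?thesis using K_pos by simp
  next
    case False
    then have N: "0 < L2norm_sq (V k)" using L2norm_sq_nonneg[of "V k"] by simp
    define s where "s = sqrt (2 * K / L2norm_sq (V k))"
    have s: "0 < s" "s\<^sup>2 = 2 * K / L2norm_sq (V k)" using N K_pos by (auto simp: s_def)
    have NsV: "L2norm_sq (\<lambda>x. s * V k x) = 2 * K"
      using N s by (simp add: L2norm_sq_cmult)
    have sV: "(\<lambda>x. s * V k x) \<in> S"
      using NsV s by (simp add: S_def unimodal_cmult uV L2R_cmult V)
    have "s * L2norm_sq (V k) = (\<integral>x. s * (V k x)\<^sup>2 \<partial>lborel)"
      by (simp add: L2norm_sq_def)
    \<comment> \<open>A truncation satisfies \<open>U x * V k x = (V k x)\<^sup>2\<close>.\<close>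
    also have "\<dots> = (\<integral>x. U x * (s * V k x) \<partial>lborel)"
      by (intro Bochner_Integration.integral_cong) (auto simp: V_def indicator_def power2_eq_square)
    also have "\<dots> \<le> T"
      using U_pairing(2)[OF S_D(1,2)[OF sV]] D_le_T[OF sV NsV] by simp
    finally have "(s * L2norm_sq (V k))\<^sup>2 \<le> T\<^sup>2"
      using s N by (intro power_mono) auto
    moreover have "(s * L2norm_sq (V k))\<^sup>2 = 2 * K * L2norm_sq (V k)"
      unfolding power_mult_distrib s(2) using N by (simp add: power2_eq_square)
    ultimately have "2 * K * L2norm_sq (V k) \<le> T\<^sup>2" by simp
    then show ?thesis using K_pos by (simp add: field_simps)
  qed
  have lim: "AE x in lborel. (\<lambda>k. V k x) \<longlonglongrightarrow> U x"
  proof (rule AE_I2)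
    fix x :: real
    have "\<forall>\<^sub>F k :: nat in sequentially. nat \<lceil>\<bar>x\<bar>\<rceil> \<le> k" by (rule eventually_ge_at_top)
    then have "\<forall>\<^sub>F k in sequentially. V k x = U x"
      by eventually_elim (auto simp: V_def indicator_def abs_le_iff nat_ceiling_le_eq)
    then show "(\<lambda>k. V k x) \<longlonglongrightarrow> U x"
      by (rule tendsto_eventually)
  qed
  show "U \<in> L2R" "L2norm_sq U \<le> T\<^sup>2 / (2 * K)"
    using L2_Fatou[OF V NV unimodal_measurable[OF U_unimodal] lim] by auto
qed

text \<open>Equality in Cauchy-Schwarz: for \<open>c = 2 * K / T\<close> the squared norm of
  \<open>W - c U\<close> expands to at most \<open>2 * K + 2 * K - 4 * K = 0\<close>.\<close>

lemma Euler_Lagrange: "AE x in lborel. (\<lambda>n. A n (grad n) x) sums (T / (2 * K) * W x)"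
proof -
  define c where "c = 2 * K / T"
  have c: "0 < c" using T_pos K_pos by (simp add: c_def)
  have i: "integrable lborel (\<lambda>x. (W x)\<^sup>2)" "integrable lborel (\<lambda>x. (U x)\<^sup>2)" "integrable lborel (\<lambda>x. U x * W x)"
    using L2R_integrable[OF S_D(2)[OF W]] L2R_integrable[OF U_L2(1)] U_pairing(1)[OF S_D(1,2)[OF W]] by auto
  have eq: "(W x - c * U x)\<^sup>2 = (W x)\<^sup>2 + (c\<^sup>2 * (U x)\<^sup>2 - 2 * c * (U x * W x))" for x
    by (simp add: power2_eq_square algebra_simps)
  have int: "integrable lborel (\<lambda>x. (W x - c * U x)\<^sup>2)"
    unfolding eq by (intro Bochner_Integration.integrable_add Bochner_Integration.integrable_diff integrable_mult_right i)
  have "(\<integral>x. (W x - c * U x)\<^sup>2 \<partial>lborel) = 2 * K + (c\<^sup>2 * L2norm_sq U - 2 * c * T)"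
    unfolding eq using i NW U_pairing(2)[OF S_D(1,2)[OF W]] by (simp add: L2norm_sq_def T_def)
  also have "\<dots> \<le> 2 * K + (c\<^sup>2 * (T\<^sup>2 / (2 * K)) - 2 * c * T)"
    by (intro add_left_mono diff_right_mono mult_left_mono U_L2) auto
  also have "\<dots> = 0"
    using T_pos K_pos by (simp add: c_def power2_eq_square)
  finally have "(\<integral>x. (W x - c * U x)\<^sup>2 \<partial>lborel) = 0"
    by (intro antisym integral_nonneg) auto
  then have "AE x in lborel. (W x - c * U x)\<^sup>2 = 0"
    using integral_nonneg_eq_0_iff_AE[OF int] by simp
  then show ?thesis
  proof eventually_elim
    case (elim x)
    then have "T / (2 * K) * W x = U x" using T_pos K_pos by (simp add: c_def)
    then show ?case using summable_sums[OF A_grad_summable[of x]] by (simp add: U_def)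
  qed
qed

end

end

lemma solution_exists:
  "\<exists>W c. W \<in> S \<and> L2norm_sq W = 2 * K \<and> 0 < c \<and>
    (AE x in lborel. (\<lambda>n. A n (\<lambda>\<xi>. g n (A n W \<xi>)) x) sums (c * W x))"
proof -
  obtain W where W: "W \<in> S" "L2norm_sq W = 2 * K" "0 < P W"
    "\<And>V. V \<in> S \<Longrightarrow> L2norm_sq V = 2 * K \<Longrightarrow> P V \<le> P W"
    using maximizer by blast
  show ?thesis
    using Euler_Lagrange[OF W] T_pos[OF W] K_pos W
    by (intro exI[of _ W] exI[of _ "T W / (2 * K)"]) auto
qed

end

section \<open>From the lattice potentials to the variational problem\<close>

theorem theorem1p2:
  fixes \<nu> K \<gamma> :: real
    and \<Phi> \<Phi>1 \<Phi>2 \<Phi>3 \<Phi>4 :: "nat \<Rightarrow> real \<Rightarrow> real"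
  assumes nu_pos: "\<nu> > 0"
    and K_pos: "0 < K" and K_bound: "K < \<nu>\<^sup>2 / 2"
    and gamma: "5/2 < \<gamma>" "\<gamma> < 3"
    and D1: "\<And>m x. m \<ge> 1 \<Longrightarrow> x \<ge> 0 \<Longrightarrow> (\<Phi> m has_real_derivative \<Phi>1 m x) (at x within {0..})"
    and D2: "\<And>m x. m \<ge> 1 \<Longrightarrow> x \<ge> 0 \<Longrightarrow> (\<Phi>1 m has_real_derivative \<Phi>2 m x) (at x within {0..})"
    and D3: "\<And>m x. m \<ge> 1 \<Longrightarrow> x \<ge> 0 \<Longrightarrow> (\<Phi>2 m has_real_derivative \<Phi>3 m x) (at x within {0..})"
    and D4: "\<And>m x. m \<ge> 1 \<Longrightarrow> x \<ge> 0 \<Longrightarrow> (\<Phi>3 m has_real_derivative \<Phi>4 m x) (at x within {0..})"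
    and C4: "\<And>m. m \<ge> 1 \<Longrightarrow> continuous_on {0..} (\<Phi>4 m)"
    and S0: "\<And>m x. m \<ge> 1 \<Longrightarrow> x \<ge> 0 \<Longrightarrow> \<Phi> m x \<ge> 0"
    and S1: "\<And>m x. m \<ge> 1 \<Longrightarrow> x \<ge> 0 \<Longrightarrow> \<Phi>1 m x \<le> 0"
    and S2: "\<And>m x. m \<ge> 1 \<Longrightarrow> x \<ge> 0 \<Longrightarrow> \<Phi>2 m x \<ge> 0"
    and S3: "\<And>m x. m \<ge> 1 \<Longrightarrow> x \<ge> 0 \<Longrightarrow> \<Phi>3 m x \<le> 0"
    and S4: "\<And>m x. m \<ge> 1 \<Longrightarrow> x \<ge> 0 \<Longrightarrow> \<Phi>4 m x \<ge> 0"
    and strict: "\<And>x. x > 0 \<Longrightarrow> \<Phi> 1 x > 0 \<and> \<Phi>1 1 x < 0 \<and> \<Phi>2 1 x > 0 \<and> \<Phi>3 1 x < 0 \<and> \<Phi>4 1 x > 0"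
    and sum1: "summable (\<lambda>m. \<Phi>1 (Suc m) (\<nu> * real (Suc m) - sqrt (2 * K * real (Suc m))) * real (Suc m))"
    and sum2: "summable (\<lambda>m. \<Phi>2 (Suc m) (\<nu> * real (Suc m) - sqrt (2 * K * real (Suc m))) * (real (Suc m))\<^sup>2)"
    and sum3: "summable (\<lambda>m. \<Phi>2 (Suc m) (\<nu> * real (Suc m)) * real (Suc m) powr \<gamma>)"
    and sum4: "summable (\<lambda>m. \<Phi>3 (Suc m) (\<nu> * real (Suc m) - sqrt (2 * K * real (Suc m))) * real (Suc m) powr (3/2))"
  shows "\<exists>W c \<eta>. W \<in> L2R \<and> L2norm_sq W = 2 * K \<and> c > 0 \<and>
           (AE x in lborel.
              (\<lambda>m. Aop (Suc m) (\<lambda>\<xi>. - \<Phi>1 (Suc m) (\<nu> * real (Suc m) - Aop (Suc m) W \<xi>)) x)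
                sums (c\<^sup>2 * W x - \<eta>))"
proof -
  define b where "b n = sqrt (2 * K * real (Suc n))" for n
  define y where "y n = \<nu> * real (Suc n)" for n
  define G where "G n u = \<Phi> (Suc n) (y n - u) - \<Phi> (Suc n) (y n) + \<Phi>1 (Suc n) (y n) * u" for n u
  define g where "g n u = \<Phi>1 (Suc n) (y n) - \<Phi>1 (Suc n) (y n - u)" for n u
  define h where "h n u = \<Phi>2 (Suc n) (y n - u)" for n u
  have b0: "0 < b n" for n using K_pos by (simp add: b_def)
  \<comment> \<open>\<open>sqrt (2 * K * m) < \<nu> * sqrt m \<le> \<nu> * m\<close>: all arguments
    stay in the interior of the half-line, where one-sided derivatives are two-sided.\<close>
  have sub: "0 < y n - u" if "u \<le> b n" for n u
  proof -
    have "sqrt (2 * K) < \<nu>"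
      using K_bound nu_pos K_pos by (intro real_less_lsqrt) auto
    then have "b n < \<nu> * sqrt (real (Suc n))"
      unfolding b_def real_sqrt_mult[of "2 * K"] by (intro mult_strict_right_mono) auto
    also have "\<dots> \<le> y n"
      unfolding y_def using nu_pos
      by (intro mult_left_mono real_le_lsqrt) (auto simp: power2_eq_square of_nat_Suc algebra_simps)
    finally show ?thesis using that by simp
  qed
  have deriv: "(f has_real_derivative d) (at x)" if "(f has_real_derivative d) (at x within {0..})" "0 < x" for f d and x :: real
    using that at_within_interior[of x "{0..}"] by (simp add: interior_real_atLeast)
  have chain: "((\<lambda>u. f (z - u)) has_real_derivative - d) (at u)"
    if "(f has_real_derivative d) (at (z - u) within {0..})" "0 < z - u" for f d z and u :: real
  proof -
    have "((\<lambda>u. z - u) has_real_derivative - 1) (at u)"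
      by (auto intro!: derivative_eq_intros)
    from DERIV_chain2[where f = f and g = "\<lambda>u. z - u", OF deriv[OF that] this] show ?thesis
      by simp
  qed
  have anti: "f y \<le> f x"
    if "\<And>x. 0 \<le> x \<Longrightarrow> (f has_real_derivative f' x) (at x within {0..})" "\<And>x. 0 \<le> x \<Longrightarrow> f' x \<le> 0" "0 < x" "x \<le> y"
    for f f' :: "real \<Rightarrow> real" and x y
  proof (rule DERIV_nonpos_imp_nonincreasing[OF that(4)])
    fix z assume "x \<le> z" "z \<le> y"
    then show "\<exists>d. (f has_real_derivative d) (at z) \<and> d \<le> 0"
      using that by (intro exI[of _ "f' z"] conjI deriv) auto
  qed
  have dh: "(h n has_real_derivative - \<Phi>3 (Suc n) (y n - u)) (at u)" if "u \<le> b n" for n u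
    unfolding h_def using sub[OF that] by (intro chain D3) auto
  have pot: "convex_potential (G n) (g n) (h n) (b n)" for n
  proof
    show "0 \<le> b n" using b0[of n] by simp
    show "G n 0 = 0" "g n 0 = 0" by (auto simp: G_def g_def)
    fix u assume u: "0 \<le> u" "u \<le> b n"
    show "(G n has_real_derivative g n u) (at u)"
      unfolding G_def g_def using sub[OF u(2)]
      by (auto intro!: derivative_eq_intros chain[OF D1])
    show "(g n has_real_derivative h n u) (at u)"
      unfolding h_def g_def using sub[OF u(2)]
      by (auto intro!: derivative_eq_intros chain[OF D2])
  next
    fix u v assume "0 \<le> u" "u \<le> v" "v \<le> b n"
    then show "h n u \<le> h n v"
      unfolding h_def using sub[of v n] by (intro anti[OF D3 S3]) auto
  next
    show "0 \<le> h n 0" unfolding h_def using sub[of 0 n] b0[of n] by (intro S2) auto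
    show "isCont (h n) 0" using dh[of 0 n] b0[of n] by (auto intro: DERIV_isCont)
  qed
  \<comment> \<open>\<open>- \<Phi>3 1\<close> decreases, so on the arguments
    \<open>\<nu> - v\<close> with \<open>v \<ge> 0\<close> its minimum is taken at
    \<open>\<nu>\<close>; the 6 is that of \<open>cubic_lower_bound\<close>.\<close>
  define \<kappa> where "\<kappa> = - \<Phi>3 1 \<nu> / 6"
  interpret potential_family K \<gamma> \<kappa> G g h
  proof (rule potential_family.intro)
    show "convex_potential (G n) (g n) (h n) (sqrt (2 * K * real (Suc n)))" for n
      using pot[of n] by (simp only: b_def)
    show "0 < \<kappa>" using strict[OF nu_pos] by (simp add: \<kappa>_def)
    have 0: "b 0 = sqrt (2 * K)" "y 0 = \<nu>" by (auto simp: b_def y_def)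
    show "h 0 0 / 2 * u\<^sup>2 + \<kappa> * u ^ 3 \<le> G 0 u" if u: "0 \<le> u" "u \<le> sqrt (2 * K)" for u
    proof -
      have "h 0 0 / 2 * u\<^sup>2 + (- \<Phi>3 1 \<nu>) / 6 * u ^ 3 \<le> G 0 u"
      proof (rule cubic_lower_bound[OF pot[of 0]])
        fix v assume v: "0 \<le> v" "v \<le> b 0"
        show "(h 0 has_real_derivative - \<Phi>3 (Suc 0) (y 0 - v)) (at v)" by (rule dh[OF v(2)])
        have "- \<Phi>3 1 (y 0) \<le> - \<Phi>3 1 (y 0 - v)"
          using sub[OF v(2)] v D4 S4
          by (intro anti[of "\<lambda>x. - \<Phi>3 1 x" "\<lambda>x. - \<Phi>4 1 x"]) (auto intro!: derivative_eq_intros)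
        then show "- \<Phi>3 1 \<nu> \<le> - \<Phi>3 (Suc 0) (y 0 - v)" by (simp add: 0)
      qed (use u 0 in auto)
      then show ?thesis by (simp add: \<kappa>_def)
    qed
    show "summable (\<lambda>n. h n (sqrt (2 * K * real (Suc n))) * (real (Suc n))\<^sup>2)"
      using sum2 by (simp only: h_def y_def)
    show "summable (\<lambda>n. h n 0 * real (Suc n) powr \<gamma>)"
      using sum3 by (simp only: h_def y_def diff_0_right)
  qed (use K_pos gamma in auto)
  obtain W c where W: "W \<in> S" "L2norm_sq W = 2 * K" and c: "0 < c"
    and sol: "AE x in lborel. (\<lambda>n. Aop (Suc n) (\<lambda>\<xi>. g n (Aop (Suc n) W \<xi>)) x) sums (c * W x)"
    using solution_exists by blast
  define \<eta> where "\<eta> = (\<Sum>n. \<Phi>1 (Suc n) (y n) * real (Suc n))"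
  \<comment> \<open>\<open>- \<Phi>1\<close> is nonnegative and decreasing, so the terms at
    \<open>y n\<close> are dominated by those of \<open>sum1\<close>, taken at the smaller argument
    \<open>y n - b n\<close>.\<close>
  have "summable (\<lambda>n. \<Phi>1 (Suc n) (y n) * real (Suc n))"
  proof (rule summable_comparison_test[OF _ summable_minus[OF sum1]], intro exI allI impI)
    fix n
    have "- \<Phi>1 (Suc n) (y n) \<le> - \<Phi>1 (Suc n) (y n - b n)"
      using sub[of "b n" n] b0[of n] D2 S2
      by (intro anti[of "\<lambda>x. - \<Phi>1 (Suc n) x" "\<lambda>x. - \<Phi>2 (Suc n) x"]) (auto intro!: derivative_eq_intros)
    moreover have "\<Phi>1 (Suc n) (y n) \<le> 0" using sub[of 0 n] b0[of n] by (intro S1) auto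
    ultimately show "norm (\<Phi>1 (Suc n) (y n) * real (Suc n))
        \<le> - (\<Phi>1 (Suc n) (\<nu> * real (Suc n) - sqrt (2 * K * real (Suc n))) * real (Suc n))"
      using mult_right_mono[of "- \<Phi>1 (Suc n) (y n)" "- \<Phi>1 (Suc n) (y n - b n)" "real (Suc n)"]
      by (simp add: abs_mult b_def y_def)
  qed
  then have \<eta>: "(\<lambda>n. \<Phi>1 (Suc n) (y n) * real (Suc n)) sums \<eta>"
    unfolding \<eta>_def by (rule summable_sums)
  \<comment> \<open>\<open>- \<Phi>1\<close> differs from \<open>g n\<close> by the constant
    \<open>\<Phi>1 (Suc n) (y n)\<close>, whose average over the window is \<open>Suc n\<close>
    times that constant; these terms add up to \<open>\<eta>\<close>.\<close>
  have split: "Aop (Suc n) (\<lambda>\<xi>. - \<Phi>1 (Suc n) (\<nu> * real (Suc n) - Aop (Suc n) W \<xi>)) x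
      = Aop (Suc n) (\<lambda>\<xi>. g n (Aop (Suc n) W \<xi>)) x - \<Phi>1 (Suc n) (y n) * real (Suc n)" for n x
  proof -
    have 1: "integrable lborel (\<lambda>t. indicator (win (Suc n) x) t * g n (Aop (Suc n) W t))"
      using L2R_win_integrable[OF grad_L2[OF W(1)]] .
    have 2: "integrable lborel (\<lambda>t. indicator (win (Suc n) x) t * \<Phi>1 (Suc n) (y n))"
      by (rule integrable_mult_left, rule integrable_real_indicator) auto
    have "Aop (Suc n) (\<lambda>\<xi>. - \<Phi>1 (Suc n) (\<nu> * real (Suc n) - Aop (Suc n) W \<xi>)) x
      = (\<integral>t. indicator (win (Suc n) x) t * g n (Aop (Suc n) W t) - indicator (win (Suc n) x) t * \<Phi>1 (Suc n) (y n) \<partial>lborel)"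
      unfolding Aop_eq by (intro Bochner_Integration.integral_cong) (auto simp: g_def y_def indicator_def)
    also have "\<dots> = Aop (Suc n) (\<lambda>\<xi>. g n (Aop (Suc n) W \<xi>)) x - Aop (Suc n) (\<lambda>_. \<Phi>1 (Suc n) (y n)) x"
      unfolding Aop_eq[of _ "\<lambda>\<xi>. g n (Aop (Suc n) W \<xi>)"] Aop_eq[of _ "\<lambda>_. \<Phi>1 (Suc n) (y n)"]
      by (rule Bochner_Integration.integral_diff[OF 1 2])
    finally show ?thesis by (simp only: Aop_const mult.commute)
  qed
  \<comment> \<open>The multiplier is the squared wave speed, so the speed is its square
    root.\<close>
  have "AE x in lborel.
      (\<lambda>m. Aop (Suc m) (\<lambda>\<xi>. - \<Phi>1 (Suc m) (\<nu> * real (Suc m) - Aop (Suc m) W \<xi>)) x)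
        sums ((sqrt c)\<^sup>2 * W x - \<eta>)"
    using sol
  proof eventually_elim
    case (elim x)
    show ?case unfolding split using sums_diff[OF elim \<eta>] c by simp
  qed
  then show ?thesis
    using W c S_D(2)[OF W(1)] by (intro exI[of _ W] exI[of _ "sqrt c"] exI[of _ \<eta>]) auto
qed

end
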